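(* Let $\Gamma=(V,E)$ be a finite graph with $|V|\ge 2$ such that there are no two distinct vertices $x,y\in V$ with $lk(x)\subset st(y)$. Then the right angled Artin group $R_\Gamma$ admits infinitely many linearly independent homogeneous Aut-invariant quasimorphisms.
   Context: A finite graph $\Gamma=(V,E)$ consists of a non-empty finite vertex set $V$ and a set $E$ of 2-element subsets of $V$ (no loops, no multiple edges). For $v\in V$, $lk(v)=\{x\in V:\{v,x\}\in E\}$ and $st(v)=lk(v)\cup\{v\}$. The right angled Artin group $R_\Gamma$ is the group generated by $V$ subject to the relations $xy=yx$ for all $\{x,y\}\in E$. A quasimorphism on a group $G$ is a map $\psi\colon G\to\mathbb{R}$ with $\sup_{g,h\in G}|\psi(g)+\psi(h)-\psi(gh)|<\infty$; it is homogeneous if $\psi(g^n)=n\psi(g)$ for all $g\in G,n\in\mathbb{Z}$, and Aut-invariant if $\psi\circ\varphi=\psi$ for every automorphism $\varphi$ of $G$. Linear independence refers to the real vector space of functions $G\to\mathbb{R}$. *)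

theory Defs
  imports "HOL-Algebra.Algebra"
begin

definition finite_graph :: "'v set \<Rightarrow> 'v set set \<Rightarrow> bool" where
  "finite_graph V E \<longleftrightarrow> finite V \<and> V \<noteq> {} \<and>
     (\<forall>e\<in>E. e \<subseteq> V \<and> card e = 2)"

definition lk :: "'v set set \<Rightarrow> 'v \<Rightarrow> 'v set" where
  "lk E v = {x. {v, x} \<in> E}"

definition st :: "'v set set \<Rightarrow> 'v \<Rightarrow> 'v set" where
  "st E v = insert v (lk E v)"

text \<open>Words in the generators and their inverses: a letter (v, True) is v,
(v, False) is v inverse.  One elementary move: cancel/insert a pair v v^-1
(or v^-1 v), or swap two adjacent letters whose generators are adjacent.\<close>

inductive raag_step :: "'v set \<Rightarrow> 'v set set \<Rightarrow> ('v \<times> bool) list \<Rightarrow> ('v \<times> bool) list \<Rightarrow> bool"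
  for V E where
  cancel: "v \<in> V \<Longrightarrow> raag_step V E (xs @ [(v, b), (v, \<not> b)] @ ys) (xs @ ys)"
| insert: "v \<in> V \<Longrightarrow> raag_step V E (xs @ ys) (xs @ [(v, b), (v, \<not> b)] @ ys)"
| swap: "{u, w} \<in> E \<Longrightarrow> raag_step V E (xs @ [(u, b), (w, c)] @ ys) (xs @ [(w, c), (u, b)] @ ys)"

definition raag_words :: "'v set \<Rightarrow> ('v \<times> bool) list set" where
  "raag_words V = lists (V \<times> UNIV)"

definition raag_equiv :: "'v set \<Rightarrow> 'v set set \<Rightarrow> ('v \<times> bool) list \<Rightarrow> ('v \<times> bool) list \<Rightarrow> bool" where
  "raag_equiv V E = (\<lambda>w w'. (raag_step V E)\<^sup>*\<^sup>* w w')"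

definition raag_class :: "'v set \<Rightarrow> 'v set set \<Rightarrow> ('v \<times> bool) list \<Rightarrow> ('v \<times> bool) list set" where
  "raag_class V E w = {w'. raag_equiv V E w w'}"

definition RAAG :: "'v set \<Rightarrow> 'v set set \<Rightarrow> ('v \<times> bool) list set monoid" where
  "RAAG V E = \<lparr> carrier = raag_class V E ` raag_words V,
     monoid.mult = (\<lambda>A B. {w. \<exists>a\<in>A. \<exists>b\<in>B. raag_equiv V E (a @ b) w}),
     monoid.one = raag_class V E [] \<rparr>"

definition quasimorphism :: "('a, 'b) monoid_scheme \<Rightarrow> ('a \<Rightarrow> real) \<Rightarrow> bool" where
  "quasimorphism G \<psi> \<longleftrightarrow>
     (\<exists>D. \<forall>g\<in>carrier G. \<forall>h\<in>carrier G. \<bar>\<psi> g + \<psi> h - \<psi> (g \<otimes>\<^bsub>G\<^esub> h)\<bar> \<le> D)"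

definition homogeneous :: "('a, 'b) monoid_scheme \<Rightarrow> ('a \<Rightarrow> real) \<Rightarrow> bool" where
  "homogeneous G \<psi> \<longleftrightarrow> (\<forall>g\<in>carrier G. \<forall>n::int. \<psi> (g [^]\<^bsub>G\<^esub> n) = of_int n * \<psi> g)"

definition aut_invariant :: "('a, 'b) monoid_scheme \<Rightarrow> ('a \<Rightarrow> real) \<Rightarrow> bool" where
  "aut_invariant G \<psi> \<longleftrightarrow> (\<forall>\<phi>\<in>iso G G. \<forall>g\<in>carrier G. \<psi> (\<phi> g) = \<psi> g)"

definition lin_indep_fun :: "('a, 'b) monoid_scheme \<Rightarrow> ('i \<Rightarrow> 'a \<Rightarrow> real) \<Rightarrow> 'i set \<Rightarrow> bool" where
  "lin_indep_fun G Q I \<longleftrightarrow>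
     (\<forall>F c. finite F \<and> F \<subseteq> I \<and> (\<forall>g\<in>carrier G. (\<Sum>i\<in>F. c i * Q i g) = 0)
        \<longrightarrow> (\<forall>i\<in>F. c i = 0))"

end

theory Submission
  imports Defs
begin

text \<open>
  If \<open>g\<close> and \<open>h\<close> commute, \<open>g\<close> has exponent sum zero in \<open>l\<close> and \<open>h\<close> does not, then \<open>g\<close> is conjugate to the
  word obtained from it by deleting all letters outside the star of \<open>l\<close>. Combined with the commutator
  relations in degree two, the absence of dominated vertices forces every automorphism to send each
  generator \<open>v\<close> to a conjugate of \<open>\<pi> v\<close> or its inverse, for a graph automorphism \<open>\<pi>\<close>. Deleting all generators but
  two nonadjacent ones \<open>x, y\<close> then turns an automorphism into an isomorphism of free groups of rank two that
  maps the generators to conjugates of generators or their inverses, and such a map is inner up to inverting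
  and renaming generators. Hence a Brooks counting function on the free group on \<open>x, y\<close>, symmetrised over signs
  and summed over all nonadjacent pairs, changes by a bounded amount under automorphisms, and its
  homogenization is invariant. Varying the counted word gives the linearly independent family.
\<close>

section \<open>Words\<close>

text \<open>Words are compared only through functions that the elementary moves respect: exponent
  sums, deletion of generators, a degree-two Magnus coefficient, and a deletion steered by a running
  exponent sum. An automorphism is always carried together with its inverse: a nonzero entry of one
  exponent-sum matrix restricts the support of the other. The obstacle is that an automorphism may
  conjugate different generators by unrelated elements, and a bounded defect alone does not control
  what this does to a subword count. Surjectivity onto the free quotient on two nonadjacent
  generators, which the inverse supplies, forces a common conjugator there. It may vary from pair to
  pair, which is harmless because each pair is counted separately. As \<pi> can carry a pair to any
  other, the counts are summed over all nonadjacent pairs. Invariance up to a bounded error becomes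
  exact after homogenization, since a bounded quantity that scales linearly under powers vanishes.
  Independence is read off from positive, hence reduced, periodic test words on which the
  homogenized functions form a diagonal matrix.\<close>

definition linv :: "'v \<times> bool \<Rightarrow> 'v \<times> bool" where
  "linv z = (fst z, \<not> snd z)"

definition winv :: "('v \<times> bool) list \<Rightarrow> ('v \<times> bool) list" where
  "winv w = rev (map linv w)"

text \<open>On words, this is the retraction that sends every generator outside \<open>S\<close> to
  the identity.\<close>

definition del :: "'v set \<Rightarrow> ('v \<times> bool) list \<Rightarrow> ('v \<times> bool) list" where
  "del S w = filter (\<lambda>z. fst z \<in> S) w"

definition sg :: "'v \<Rightarrow> 'v \<times> bool \<Rightarrow> int" where
  "sg v z = (if fst z = v then (if snd z then 1 else - 1) else 0)"

definition es :: "'v \<Rightarrow> ('v \<times> bool) list \<Rightarrow> int" where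
  "es v w = sum_list (map (sg v) w)"

lemma linv_linv [simp]: "linv (linv z) = z"
  by (simp add: linv_def)

lemma fst_linv [simp]: "fst (linv z) = fst z"
  by (simp add: linv_def)

lemma linv_eq_iff [simp]: "linv a = linv b \<longleftrightarrow> a = b"
  by (metis linv_linv)

lemma winv_Nil [simp]: "winv [] = []"
  and winv_Cons: "winv (z # w) = winv w @ [linv z]"
  and winv_append [simp]: "winv (a @ b) = winv b @ winv a"
  and winv_winv [simp]: "winv (winv w) = w"
  and length_winv [simp]: "length (winv w) = length w"
  by (simp_all add: winv_def rev_map comp_def)

lemma winv_single [simp]: "winv [z] = [linv z]"
  by (simp add: winv_def)

lemma winv_eq_Nil_iff [simp]: "winv w = [] \<longleftrightarrow> w = []"
  by (simp add: winv_def)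

lemma set_winv: "set (winv w) = linv ` set w"
  by (simp add: winv_def)

lemma del_simps [simp]:
  "del S [] = []" "del S (a @ b) = del S a @ del S b"
  "del S (z # w) = (if fst z \<in> S then z # del S w else del S w)"
  by (simp_all add: del_def)

lemma del_del [simp]: "del S (del T w) = del (S \<inter> T) w"
  by (simp add: del_def conj_commute)

lemma del_winv: "del S (winv w) = winv (del S w)"
  by (induction w) (simp_all add: winv_Cons)

lemma set_del: "set (del S w) = {z \<in> set w. fst z \<in> S}"
  by (simp add: del_def)

lemma del_id: "fst ` set w \<subseteq> S \<Longrightarrow> del S w = w"
  by (induction w) auto

lemma sg_linv [simp]: "sg v (linv z) = - sg v z"
  by (simp add: sg_def linv_def)

lemma es_simps [simp]:
  "es v [] = 0" "es v (z # w) = sg v z + es v w" "es v (a @ b) = es v a + es v b"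
  by (simp_all add: es_def)

lemma es_winv [simp]: "es v (winv w) = - es v w"
  by (induction w) (simp_all add: winv_Cons)

lemma es_del: "v \<in> S \<Longrightarrow> es v (del S w) = es v w"
  by (induction w) (auto simp: sg_def)

lemma es_concat_replicate [simp]: "es v (concat (replicate n w)) = int n * es v w"
  by (induction n) (simp_all add: algebra_simps)

text \<open>For distinct \<open>i\<close> and \<open>j\<close> this is the coefficient of the
  monomial \<open>i j\<close> in the Magnus expansion: signed occurrences of \<open>i\<close>
  standing before signed occurrences of \<open>j\<close>.\<close>

primrec pair_count :: "'v \<Rightarrow> 'v \<Rightarrow> ('v \<times> bool) list \<Rightarrow> int" where
  "pair_count i j [] = 0"
| "pair_count i j (z # w) = sg i z * es j w + pair_count i j w"

lemma pair_count_append: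
  "pair_count i j (a @ b) = pair_count i j a + pair_count i j b + es i a * es j b"
  by (induction a) (simp_all add: algebra_simps)

text \<open>The counter \<open>c\<close> is the current height, the exponent sum of \<open>l\<close>
  read so far. Letters outside \<open>S\<close> at different heights behave like different
  generators, conjugated by different powers of \<open>l\<close>; those at height above
  \<open>N\<close> in absolute value are killed.\<close>

primrec scan :: "'v set \<Rightarrow> 'v \<Rightarrow> int \<Rightarrow> int \<Rightarrow> ('v \<times> bool) list \<Rightarrow> ('v \<times> bool) list" where
  "scan S l N c [] = []"
| "scan S l N c (z # w) =
     (if fst z \<in> S \<or> \<bar>c\<bar> \<le> N then [z] else []) @ scan S l N (c + sg l z) w"

lemma scan_append: "scan S l N c (a @ b) = scan S l N c a @ scan S l N (c + es l a) b"
  by (induction a arbitrary: c) (simp_all add: add.assoc)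

lemma scan_near: "\<bar>c\<bar> + int (length w) \<le> N \<Longrightarrow> scan S l N c w = w"
proof (induction w arbitrary: c)
  case (Cons z w)
  have "\<bar>c + sg l z\<bar> \<le> \<bar>c\<bar> + 1" by (auto simp: sg_def)
  with Cons show ?case by simp
qed simp

lemma scan_far: "N + int (length w) < \<bar>c\<bar> \<Longrightarrow> scan S l N c w = del S w"
proof (induction w arbitrary: c)
  case (Cons z w)
  have "\<bar>c\<bar> \<le> \<bar>c + sg l z\<bar> + 1" by (auto simp: sg_def)
  with Cons show ?case by simp
qed simp

lemma set_scan: "set (scan S l N c w) \<subseteq> set w"
  by (induction w arbitrary: c) auto

section \<open>Equality in a right angled Artin group\<close>

locale raag =
  fixes V :: "'v set" and E :: "'v set set"
  assumes graph: "finite_graph V E"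
begin

abbreviation eqv (infix "\<doteq>" 50) where "w \<doteq> w' \<equiv> raag_equiv V E w w'"

abbreviation words where "words \<equiv> raag_words V"

lemma words_simps [simp]:
  "[] \<in> words" "z # w \<in> words \<longleftrightarrow> fst z \<in> V \<and> w \<in> words"
  "a @ b \<in> words \<longleftrightarrow> a \<in> words \<and> b \<in> words"
  by (auto simp: raag_words_def mem_Times_iff)

lemma words_iff: "w \<in> words \<longleftrightarrow> fst ` set w \<subseteq> V"
  by (auto simp: raag_words_def lists_eq_set mem_Times_iff)

lemma winv_words [simp]: "winv w \<in> words \<longleftrightarrow> w \<in> words"
  by (simp add: words_iff set_winv image_image)

lemma del_words [simp]: "w \<in> words \<Longrightarrow> del S w \<in> words"
  by (auto simp: words_iff set_del)

lemma scan_words: "w \<in> words \<Longrightarrow> scan S l N c w \<in> words"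
  using set_scan by (fastforce simp: words_iff)

lemma concat_words: "(\<And>a. a \<in> set ws \<Longrightarrow> a \<in> words) \<Longrightarrow> concat ws \<in> words"
  by (induction ws) auto

lemma edgeD: "{u, w} \<in> E \<Longrightarrow> u \<noteq> w \<and> u \<in> V \<and> w \<in> V"
  using graph unfolding finite_graph_def by fastforce

lemma finite_V: "finite V"
  using graph by (simp add: finite_graph_def)

lemma lk_sym: "x \<in> lk E y \<longleftrightarrow> y \<in> lk E x"
  by (simp add: lk_def insert_commute)

lemma st_sym: "x \<in> st E y \<longleftrightarrow> y \<in> st E x"
  using lk_sym by (auto simp: st_def)

lemma lk_V: "lk E v \<subseteq> V"
  using edgeD by (auto simp: lk_def)

lemma lk_irrefl: "v \<notin> lk E v"
  using edgeD[of v v] by (auto simp: lk_def)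

lemma eqv_refl [simp, intro!]: "w \<doteq> w"
  by (simp add: raag_equiv_def)

lemma eqv_trans [trans]: "a \<doteq> b \<Longrightarrow> b \<doteq> c \<Longrightarrow> a \<doteq> c"
  unfolding raag_equiv_def by (rule rtranclp_trans)

lemma step_sym: "raag_step V E a b \<Longrightarrow> raag_step V E b a"
proof (induction rule: raag_step.induct)
  case (cancel v xs b ys)
  then show ?case by (rule raag_step.insert)
next
  case (insert v xs ys b)
  then show ?case by (rule raag_step.cancel)
next
  case (swap u w xs b c ys)
  then show ?case using raag_step.swap[of w u] by (simp add: insert_commute)
qed

lemma eqv_sym: "a \<doteq> b \<Longrightarrow> b \<doteq> a"
  unfolding raag_equiv_def
  by (induction rule: rtranclp_induct) (auto intro: converse_rtranclp_into_rtranclp step_sym)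

lemma step_context: "raag_step V E a b \<Longrightarrow> raag_step V E (p @ a @ q) (p @ b @ q)"
proof (induction rule: raag_step.induct)
  case (cancel v xs b ys)
  then show ?case using raag_step.cancel[of v V E "p @ xs" b "ys @ q"] by simp
next
  case (insert v xs ys b)
  then show ?case using raag_step.insert[of v V E "p @ xs" "ys @ q" b] by simp
next
  case (swap u w xs b c ys)
  then show ?case using raag_step.swap[of u w E V "p @ xs" b c "ys @ q"] by simp
qed

lemma eqv_context: "a \<doteq> b \<Longrightarrow> p @ a @ q \<doteq> p @ b @ q"
  unfolding raag_equiv_def
  by (induction rule: rtranclp_induct) (auto intro: rtranclp.rtrancl_into_rtrancl step_context)

lemma eqv_append: "a \<doteq> b \<Longrightarrow> c \<doteq> d \<Longrightarrow> a @ c \<doteq> b @ d"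
  using eqv_context[of a b "[]" c] eqv_context[of c d b "[]"] eqv_trans by simp

lemma step_words: "raag_step V E a b \<Longrightarrow> a \<in> words \<Longrightarrow> b \<in> words"
  by (induction rule: raag_step.induct) auto

lemma eqv_words: "a \<doteq> b \<Longrightarrow> a \<in> words \<longleftrightarrow> b \<in> words"
proof -
  have "a \<doteq> b \<Longrightarrow> a \<in> words \<Longrightarrow> b \<in> words" for a b
    unfolding raag_equiv_def by (induction rule: rtranclp_induct) (auto intro: step_words)
  then show "a \<doteq> b \<Longrightarrow> a \<in> words \<longleftrightarrow> b \<in> words" using eqv_sym by blast
qed

lemma class_eq_iff: "raag_class V E a = raag_class V E b \<longleftrightarrow> a \<doteq> b"
  unfolding raag_class_def using eqv_refl eqv_trans eqv_sym by blast

text \<open>Insertion reverses cancellation, so two kinds of move have to be checked. Taking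
  \<open>f\<close> with values in classes turns this into a well-definedness test for maps on
  words.\<close>

lemma eqv_invariant:
  assumes eq: "w \<doteq> w'"
    and c: "\<And>xs v b ys. v \<in> V \<Longrightarrow> f (xs @ [(v, b), (v, \<not> b)] @ ys) = f (xs @ ys)"
    and s: "\<And>xs u b w c ys. {u, w} \<in> E \<Longrightarrow>
              f (xs @ [(u, b), (w, c)] @ ys) = f (xs @ [(w, c), (u, b)] @ ys)"
  shows "f w = f w'"
proof -
  have "f a = f b" if "raag_step V E a b" for a b
    using that
  proof (induction rule: raag_step.induct)
    case (swap u w xs b c ys)
    then show ?case by (rule s)
  qed (simp_all only: c)
  note step = this
  show ?thesis using eq unfolding raag_equiv_def
    by (induction rule: rtranclp_induct) (simp_all add: step)
qed

lemma letter_cancel: "fst z \<in> V \<Longrightarrow> [z, linv z] \<doteq> []"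
  using raag_step.cancel[of "fst z" V E "[]" "snd z" "[]"]
  by (simp add: raag_equiv_def linv_def r_into_rtranclp)

lemma letter_swap: "{u, w} \<in> E \<Longrightarrow> [(u, b), (w, c)] \<doteq> [(w, c), (u, b)]"
  using raag_step.swap[of u w E V "[]" b c "[]"]
  by (simp add: raag_equiv_def r_into_rtranclp)

lemma right_inv: "w \<in> words \<Longrightarrow> w @ winv w \<doteq> []"
proof (induction w)
  case (Cons z w)
  then have "[z] @ (w @ winv w) @ [linv z] \<doteq> [z] @ [] @ [linv z]"
    by (intro eqv_context) auto
  also have "\<dots> \<doteq> []" using Cons letter_cancel by simp
  finally show ?case by (simp add: winv_Cons)
qed simp

lemma left_inv: "w \<in> words \<Longrightarrow> winv w @ w \<doteq> []"
  using right_inv[of "winv w"] by simp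

lemma eqv_cancel_left:
  assumes "w \<in> words" "w @ a \<doteq> w @ b" shows "a \<doteq> b"
proof -
  have *: "winv w @ w @ c \<doteq> c" for c
    using eqv_append[OF left_inv[OF assms(1)] eqv_refl[of c]] by simp
  show ?thesis
    using eqv_trans[OF eqv_trans[OF eqv_sym[OF *[of a]] eqv_append[OF eqv_refl assms(2)]] *] .
qed

lemma eqv_move_right:
  assumes "w \<in> words" "a @ w \<doteq> b" shows "a \<doteq> b @ winv w"
proof -
  have "a \<doteq> a @ w @ winv w"
    using eqv_append[OF eqv_refl[of a] right_inv[OF assms(1)]] eqv_sym by simp
  also have "\<dots> \<doteq> b @ winv w" using eqv_append[OF assms(2) eqv_refl] by simp
  finally show ?thesis .
qed

lemma eqv_winv:
  assumes "a \<doteq> b" "a \<in> words" shows "winv a \<doteq> winv b"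
proof -
  have b: "b \<in> words" using assms eqv_words by blast
  have "a @ winv a \<doteq> b @ winv b"
    using right_inv[OF assms(2)] right_inv[OF b] eqv_sym eqv_trans by blast
  also have "\<dots> \<doteq> a @ winv b" by (intro eqv_append eqv_sym[OF assms(1)] eqv_refl)
  finally show ?thesis using eqv_cancel_left assms(2) by blast
qed

lemma eqv_es: "a \<doteq> b \<Longrightarrow> es v a = es v b"
  by (rule eqv_invariant[where f = "es v"]) (auto simp: sg_def)

lemma eqv_del: "a \<doteq> b \<Longrightarrow> del S a \<doteq> del S b"
proof -
  assume "a \<doteq> b"
  then have "raag_class V E (del S a) = raag_class V E (del S b)"
  proof (rule eqv_invariant[where f = "\<lambda>w. raag_class V E (del S w)"], goal_cases)
    case (1 xs v b ys)
    show ?case unfolding class_eq_iff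
      using eqv_context[OF letter_cancel[of "(v, b)"], of "del S xs" "del S ys"] 1
      by (auto simp: linv_def)
  next
    case (2 xs u b w c ys)
    show ?case unfolding class_eq_iff
      using eqv_context[OF letter_swap[OF 2, of b c], of "del S xs" "del S ys"] by auto
  qed
  then show ?thesis by (simp add: class_eq_iff)
qed

text \<open>A cancelling pair involves one generator, so it cannot serve as both \<open>i\<close>
  and \<open>j\<close>, and its two signs cancel in the cross terms. A swap alters the count only if
  it exchanges \<open>i\<close> with \<open>j\<close>, which nonadjacency forbids.\<close>

lemma eqv_pair_count:
  assumes "a \<doteq> b" "{i, j} \<notin> E" "i \<noteq> j"
  shows "pair_count i j a = pair_count i j b"
proof (rule eqv_invariant[OF assms(1), where f = "pair_count i j"], goal_cases)
  case (1 xs v b ys)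
  then show ?case using assms by (auto simp: pair_count_append sg_def algebra_simps)
next
  case (2 xs u b w c ys)
  then have "\<not> (u = i \<and> w = j)" "\<not> (u = j \<and> w = i)"
    using assms by (auto simp: insert_commute)
  then show ?case by (auto simp: pair_count_append sg_def algebra_simps)
qed

text \<open>In \<open>pair_count_append\<close> everything except the product of exponent sums is
  symmetric in the two factors. Thus the 2x2 minors of the exponent vectors at nonadjacent positions
  vanish.\<close>

lemma commute_es:
  assumes "g @ h \<doteq> h @ g" "{i, j} \<notin> E" "i \<noteq> j"
  shows "es i g * es j h = es j g * es i h"
  using eqv_pair_count[OF assms] by (simp add: pair_count_append)

text \<open>Only letters \<open>l\<close> move the counter. They are always kept, and so are the
  letters they may be swapped with, because these lie in the star of \<open>l\<close>. Hence neither
  move changes which of the surviving letters are kept, and two cancelling letters are kept or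
  dropped together.\<close>

lemma eqv_scan:
  assumes "a \<doteq> b" shows "scan (st E l) l N c a \<doteq> scan (st E l) l N c b"
proof -
  let ?s = "scan (st E l) l N"
  have "raag_class V E (?s c a) = raag_class V E (?s c b)"
  proof (rule eqv_invariant[OF assms, where f = "\<lambda>w. raag_class V E (?s c w)"], goal_cases)
    case (1 xs v b ys)
    define d where "d = c + es l xs"
    define k where "k \<longleftrightarrow> v \<in> st E l \<or> \<bar>d\<bar> \<le> N"
    have k': "v \<in> st E l \<or> \<bar>d + sg l (v, b)\<bar> \<le> N \<longleftrightarrow> k"
      by (cases "v = l") (simp_all add: k_def sg_def st_def)
    have e: "d + (sg l (v, b) + sg l (v, \<not> b)) = d" by (simp add: sg_def)
    have "?s d [(v, b), (v, \<not> b)] = (if k then [(v, b), (v, \<not> b)] else [])"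
      by (simp add: k' k_def[symmetric])
    moreover have "?s c xs @ (if k then [(v, b), (v, \<not> b)] else []) @ ?s d ys
        \<doteq> ?s c xs @ [] @ ?s d ys"
      using letter_cancel[of "(v, b)"] 1 by (intro eqv_context) (simp add: linv_def)
    ultimately show ?case
      unfolding class_eq_iff scan_append d_def[symmetric] by (simp add: e)
  next
    case (2 xs u b w e ys)
    define d where "d = c + es l xs"
    define j k where "j \<longleftrightarrow> u \<in> st E l \<or> \<bar>d\<bar> \<le> N" and "k \<longleftrightarrow> w \<in> st E l \<or> \<bar>d\<bar> \<le> N"
    have st: "u = l \<Longrightarrow> w \<in> st E l" "w = l \<Longrightarrow> u \<in> st E l"
      using 2 by (auto simp: st_def lk_def insert_commute)
    have j': "u \<in> st E l \<or> \<bar>d + sg l (w, e)\<bar> \<le> N \<longleftrightarrow> j"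
      using st by (cases "w = l") (simp_all add: j_def sg_def)
    have k': "w \<in> st E l \<or> \<bar>d + sg l (u, b)\<bar> \<le> N \<longleftrightarrow> k"
      using st by (cases "u = l") (simp_all add: k_def sg_def)
    have "?s d [(u, b), (w, e)] = (if j then [(u, b)] else []) @ (if k then [(w, e)] else [])"
      by (simp add: k' j_def[symmetric])
    moreover have "?s d [(w, e), (u, b)] = (if k then [(w, e)] else []) @ (if j then [(u, b)] else [])"
      by (simp add: j' k_def[symmetric])
    moreover have "?s c xs @ ((if j then [(u, b)] else []) @ (if k then [(w, e)] else [])) @ q
        \<doteq> ?s c xs @ ((if k then [(w, e)] else []) @ (if j then [(u, b)] else [])) @ q" for q
      using letter_swap[OF 2] by (intro eqv_context) simp
    moreover have "es l [(u, b), (w, e)] = es l [(w, e), (u, b)]" by simp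
    ultimately show ?case
      unfolding class_eq_iff scan_append d_def[symmetric] by metis
  qed
  then show ?thesis by (simp add: class_eq_iff)
qed

section \<open>Commuting elements and conjugation into a star\<close>

lemma commute_power:
  assumes "g @ h \<doteq> h @ g"
  shows "g @ concat (replicate n h) \<doteq> concat (replicate n h) @ g"
proof (induction n)
  case (Suc n)
  have "(g @ h) @ concat (replicate n h) \<doteq> (h @ g) @ concat (replicate n h)"
    using assms eqv_append by blast
  also have "\<dots> \<doteq> h @ concat (replicate n h) @ g"
    using eqv_append[OF eqv_refl Suc.IH] by simp
  finally show ?case by simp
qed simp

text \<open>Passing to the kernel of the exponent sum of \<open>l\<close>, a conjugate of the shift induced by a power
  of \<open>h\<close> fixes \<open>g\<close>; letters outside the star of \<open>l\<close> are shifted away from themselves,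
  so they can be deleted up to conjugation.\<close>

lemma commute_conj_star:
  assumes g: "g \<in> words" and h: "h \<in> words" and com: "g @ h \<doteq> h @ g"
    and "es l g = 0" "es l h \<noteq> 0"
  shows "\<exists>u\<in>words. g \<doteq> u @ del (st E l) g @ winv u"
proof -
  define N where "N = int (length g)"
  \<comment> \<open>After \<open>n\<close> copies of \<open>h\<close> the height is a nonzero
    multiple of \<open>n\<close>, hence at least \<open>2 * N + 1\<close> in absolute value. Reading
    the \<open>N\<close> letters of \<open>g\<close> from there never re-enters the window.\<close>
  define n where "n = nat (2 * N + 1)"
  define u where "u = scan (st E l) l N 0 (concat (replicate n h))"
  have u: "u \<in> words" unfolding u_def using h by (intro scan_words concat_words) auto
  have "int n * 1 \<le> int n * \<bar>es l h\<bar>" using assms by (intro mult_left_mono) auto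
  moreover have "int n = N + int (length g) + 1" by (simp add: n_def N_def)
  ultimately have "N + int (length g) < \<bar>int n * es l h\<bar>" unfolding abs_mult by linarith
  then have far: "scan (st E l) l N (int n * es l h) g = del (st E l) g" by (rule scan_far)
  have near: "scan (st E l) l N 0 g = g" by (rule scan_near) (simp add: N_def)
  \<comment> \<open>Scan both sides of the commutation of \<open>g\<close> with the power of
    \<open>h\<close>. On the left \<open>g\<close> is read near height 0 and returns to 0; on the
    right it is read far away.\<close>
  have "g @ u \<doteq> u @ del (st E l) g"
    using eqv_scan[OF commute_power[OF com, of n], of l N 0] assms(4)
    by (simp add: scan_append near far u_def)
  then show ?thesis using eqv_move_right[OF u] u by (metis append.assoc)
qed

lemma single_letter_word:
  assumes "fst ` set w \<subseteq> {x}" "w \<in> words" "es x w = (if b then 1 else - 1)"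
  shows "w \<doteq> [(x, b)]"
proof -
  define pw where "pw k = replicate (nat k) (x, True) @ replicate (nat (- k)) (x, False)" for k :: int
  have pw_n: "pw (int n) = replicate n (x, True)" and pw_m: "pw (- int n) = replicate n (x, False)" for n
    by (simp_all add: pw_def)
  have step: "[(x, e)] @ pw k \<doteq> pw (sg x (x, e) + k)" if x: "x \<in> V" for e k
  proof -
    have T: "[(x, e), (x, \<not> e)] @ q \<doteq> [] @ q" for q e
      using letter_cancel[of "(x, e)"] x by (intro eqv_append) (simp_all add: linv_def)
    show ?thesis
    proof (cases k rule: int_cases2)
      case (nonneg n)
      show ?thesis
      proof (cases e)
        case True
        have "sg x (x, e) + k = int (Suc n)" using nonneg True by (simp add: sg_def)
        then show ?thesis unfolding nonneg pw_n using True by (simp only: pw_n) simp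
      next
        case False
        show ?thesis
        proof (cases n)
          case 0
          then show ?thesis using False nonneg by (simp add: sg_def pw_def)
        next
          case (Suc m)
          have "sg x (x, e) + k = int m" using nonneg False Suc by (simp add: sg_def)
          moreover have "pw k = (x, True) # replicate m (x, True)"
            using nonneg Suc pw_n[of "Suc m"] by simp
          ultimately show ?thesis using False T[of False] by (simp add: pw_n)
        qed
      qed
    next
      case (nonpos n)
      show ?thesis
      proof (cases e)
        case False
        have "sg x (x, e) + k = - int (Suc n)" using nonpos False by (simp add: sg_def)
        then show ?thesis unfolding nonpos pw_m using False by (simp only: pw_m) simp
      next
        case True
        show ?thesis
        proof (cases n)
          case 0
          then show ?thesis using True nonpos by (simp add: sg_def pw_def)
        next
          case (Suc m)
          have "sg x (x, e) + k = - int m" using nonpos True Suc by (simp add: sg_def)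
          moreover have "pw k = (x, False) # replicate m (x, False)"
            using nonpos Suc pw_m[of "Suc m"] by simp
          ultimately show ?thesis using True T[of True] by (simp add: pw_m)
        qed
      qed
    qed
  qed
  have "w \<doteq> pw (es x w)"
    using assms(1,2)
  proof (induction w)
    case (Cons z w)
    obtain e where z: "z = (x, e)" using Cons.prems by (cases z) auto
    have "[z] @ w \<doteq> [z] @ pw (es x w)" using Cons by (intro eqv_append) auto
    also have "\<dots> \<doteq> pw (es x (z # w))" using step Cons.prems z by simp
    finally show ?case by simp
  qed (simp add: pw_def)
  then show ?thesis using assms(3) by (cases b) (simp_all add: pw_def)
qed

end

section \<open>Automorphisms\<close>

text \<open>An automorphism and its inverse act on chosen representatives, so every law holds only
  up to \<open>\<doteq>\<close>. The axioms are symmetric in \<Phi> and \<Psi>, which lets each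
  result be applied to the inverse as well.\<close>

locale raag_aut = raag V E
  for V :: "'v set" and E :: "'v set set" +
  fixes \<Phi> \<Psi> :: "('v \<times> bool) list \<Rightarrow> ('v \<times> bool) list"
  assumes \<Phi>_words: "w \<in> words \<Longrightarrow> \<Phi> w \<in> words"
    and \<Psi>_words: "w \<in> words \<Longrightarrow> \<Psi> w \<in> words"
    and \<Phi>_append: "a \<in> words \<Longrightarrow> b \<in> words \<Longrightarrow> \<Phi> (a @ b) \<doteq> \<Phi> a @ \<Phi> b"
    and \<Psi>_append: "a \<in> words \<Longrightarrow> b \<in> words \<Longrightarrow> \<Psi> (a @ b) \<doteq> \<Psi> a @ \<Psi> b"
    and \<Phi>_cong: "a \<in> words \<Longrightarrow> a \<doteq> b \<Longrightarrow> \<Phi> a \<doteq> \<Phi> b"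
    and \<Psi>_cong: "a \<in> words \<Longrightarrow> a \<doteq> b \<Longrightarrow> \<Psi> a \<doteq> \<Psi> b"
    and \<Psi>_\<Phi>: "w \<in> words \<Longrightarrow> \<Psi> (\<Phi> w) \<doteq> w"
    and \<Phi>_\<Psi>: "w \<in> words \<Longrightarrow> \<Phi> (\<Psi> w) \<doteq> w"
    and no_domination: "x \<in> V \<Longrightarrow> y \<in> V \<Longrightarrow> lk E x \<subseteq> st E y \<Longrightarrow> x = y"
begin

abbreviation gen :: "'v \<Rightarrow> ('v \<times> bool) list" where "gen v \<equiv> [(v, True)]"

lemma inverse_aut: "raag_aut V E \<Psi> \<Phi>"
  by unfold_locales (fact \<Phi>_words \<Psi>_words \<Phi>_append \<Psi>_append \<Phi>_cong \<Psi>_cong \<Psi>_\<Phi> \<Phi>_\<Psi> no_domination)+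

lemma \<Phi>_Nil: "\<Phi> [] \<doteq> []"
  using eqv_cancel_left[of "\<Phi> []" "\<Phi> []" "[]"] \<Phi>_append[of "[]" "[]"] \<Phi>_words[of "[]"] eqv_sym
  by simp

lemma \<Phi>_winv:
  assumes "w \<in> words" shows "\<Phi> (winv w) \<doteq> winv (\<Phi> w)"
proof -
  have "\<Phi> w @ \<Phi> (winv w) \<doteq> \<Phi> (w @ winv w)" using \<Phi>_append assms eqv_sym by simp
  also have "\<dots> \<doteq> \<Phi> []" using \<Phi>_cong right_inv assms by simp
  also have "\<dots> \<doteq> []" by (rule \<Phi>_Nil)
  also have "[] \<doteq> \<Phi> w @ winv (\<Phi> w)" using right_inv[OF \<Phi>_words[OF assms]] eqv_sym by blast
  finally show ?thesis using eqv_cancel_left \<Phi>_words assms by blast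
qed

lemma \<Phi>_commute:
  assumes "a \<in> words" "b \<in> words" "a @ b \<doteq> b @ a" shows "\<Phi> a @ \<Phi> b \<doteq> \<Phi> b @ \<Phi> a"
  using \<Phi>_append \<Phi>_cong assms eqv_trans eqv_sym by (metis words_simps(3))

lemma gen_commute: "u \<in> st E v \<Longrightarrow> gen u @ gen v \<doteq> gen v @ gen u"
  using letter_swap[of u v] by (auto simp: st_def lk_def insert_commute)

lemma st_V: "v \<in> V \<Longrightarrow> st E v \<subseteq> V"
  using lk_V by (auto simp: st_def)

lemma \<Phi>_gen_commute: "v \<in> V \<Longrightarrow> u \<in> st E v \<Longrightarrow> \<Phi> (gen u) @ \<Phi> (gen v) \<doteq> \<Phi> (gen v) @ \<Phi> (gen u)"
  using st_V by (intro \<Phi>_commute gen_commute) auto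

section \<open>The induced matrix on exponent sums\<close>

lemma es_outside: "w \<in> words \<Longrightarrow> s \<notin> V \<Longrightarrow> es s w = 0"
  by (induction w) (auto simp: sg_def)

lemma es_\<Phi>:
  assumes "w \<in> words" shows "es z (\<Phi> w) = (\<Sum>v\<in>V. es v w * es z (\<Phi> (gen v)))"
  using assms
proof (induction w)
  case Nil
  then show ?case using eqv_es[OF \<Phi>_Nil, of z] by simp
next
  case (Cons c w)
  obtain u b where c: "c = (u, b)" by (cases c)
  have u: "u \<in> V" using Cons c by simp
  have "es z (\<Phi> [c]) = sg u c * es z (\<Phi> (gen u))"
    using eqv_es[OF \<Phi>_winv[of "gen u"], of z] u
    by (cases b) (simp_all add: c sg_def linv_def)
  also have "\<dots> = (\<Sum>v\<in>V. sg v c * es z (\<Phi> (gen v)))"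
    using u finite_V by (subst sum.remove[of V u]) (auto simp: sg_def c intro!: sum.neutral)
  finally show ?case
    using eqv_es[OF \<Phi>_append[of "[c]" w], of z] Cons by (simp add: sum.distrib distrib_right)
qed

text \<open>The two exponent-sum matrices are inverse to each other, so a diagonal entry 1 of their
  product has a nonzero summand. Its index \<open>w\<close> is the candidate for the image of
  \<open>v\<close>.\<close>

lemma dual_generator:
  assumes "v \<in> V" shows "\<exists>w\<in>V. es w (\<Phi> (gen v)) \<noteq> 0 \<and> es v (\<Psi> (gen w)) \<noteq> 0"
proof (rule ccontr)
  assume c: "\<not> ?thesis"
  interpret i: raag_aut V E \<Psi> \<Phi> by (rule inverse_aut)
  have "1 = es v (\<Psi> (\<Phi> (gen v)))" using eqv_es[OF \<Psi>_\<Phi>[of "gen v"], of v] assms by (simp add: sg_def)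
  also have "\<dots> = (\<Sum>w\<in>V. es w (\<Phi> (gen v)) * es v (\<Psi> (gen w)))"
    using assms by (intro i.es_\<Phi> \<Phi>_words) simp
  also have "\<dots> = 0" using c by (intro sum.neutral) auto
  finally show False by simp
qed

text \<open>Up to a scalar and a multiple of \<open>w\<close>, each \<open>l\<close> in the link of \<open>w\<close> is the image of a vector
  supported on the star of \<open>v\<close>, hence commutes with the image of \<open>v\<close> in degree two.\<close>

lemma image_support_star:
  assumes v: "v \<in> V" and w: "w \<in> V" and l: "l \<in> lk E w"
    and nz: "es v (\<Psi> (gen w)) \<noteq> 0" "es s (\<Phi> (gen v)) \<noteq> 0"
  shows "s \<in> st E l"
proof (rule ccontr)
  assume s: "s \<notin> st E l"
  interpret i: raag_aut V E \<Psi> \<Phi> by (rule inverse_aut)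
  have lV: "l \<in> V" and lw: "l \<noteq> w" and sw: "s \<noteq> w"
    using l lk_V lk_irrefl s lk_sym by (auto simp: st_def)
  have ls: "{l, s} \<notin> E" "l \<noteq> s" using s by (auto simp: st_def lk_def)
  \<comment> \<open>With \<alpha> = \<open>es v (\<Psi> (gen w))\<close> and \<beta> =
    \<open>es v (\<Psi> (gen l))\<close>, this is the exponent vector of the \<Psi>-image of
    \<alpha> l - \<beta> w. Its entries are minors, so commutation of \<open>l\<close> and
    \<open>w\<close> makes them vanish off the star of \<open>v\<close>.\<close>
  define d where "d j = es v (\<Psi> (gen w)) * es j (\<Psi> (gen l)) - es v (\<Psi> (gen l)) * es j (\<Psi> (gen w))" for j
  have d0: "d j = 0" if "j \<notin> st E v" for j
  proof -
    have "\<Psi> (gen l) @ \<Psi> (gen w) \<doteq> \<Psi> (gen w) @ \<Psi> (gen l)"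
      using l w by (intro i.\<Phi>_gen_commute) (auto simp: st_def)
    moreover have "{v, j} \<notin> E" "v \<noteq> j" using that by (auto simp: st_def lk_def)
    ultimately show ?thesis using commute_es by (fastforce simp: d_def)
  qed
  define z where "z k = (\<Sum>j\<in>V. d j * es k (\<Phi> (gen j)))" for k
  have z: "z k = es v (\<Psi> (gen w)) * es k (gen l) - es v (\<Psi> (gen l)) * es k (gen w)" for k
  proof -
    have "es k (gen y) = (\<Sum>j\<in>V. es j (\<Psi> (gen y)) * es k (\<Phi> (gen j)))" if "y \<in> V" for y
      using es_\<Phi>[of "\<Psi> (gen y)" k] eqv_es[OF \<Phi>_\<Psi>[of "gen y"], of k] \<Psi>_words[of "gen y"] that by simp
    from this[OF lV] this[OF w] show ?thesis
      unfolding z_def d_def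
      by (simp only: left_diff_distrib sum_subtractf sum_distrib_left mult.assoc)
  qed
  \<comment> \<open>Each generator in the support of \<open>d\<close> commutes with
    \<open>v\<close>, so the minor identity extends linearly to \<open>z\<close>. It is
    contradictory: \<open>z l\<close> is the nonzero \<alpha>, while \<open>z s\<close> is 0 because
    \<open>s\<close> is neither \<open>l\<close> nor \<open>w\<close>.\<close>
  have "z l * es s (\<Phi> (gen v)) = z s * es l (\<Phi> (gen v))"
    unfolding z_def sum_distrib_right
  proof (rule sum.cong[OF refl])
    fix j assume "j \<in> V"
    show "d j * es l (\<Phi> (gen j)) * es s (\<Phi> (gen v)) = d j * es s (\<Phi> (gen j)) * es l (\<Phi> (gen v))"
      using d0 commute_es[OF \<Phi>_gen_commute[OF v] ls] by (cases "j \<in> st E v") auto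
  qed
  then show False using nz lw sw ls by (simp add: z sg_def)
qed

text \<open>Running over all \<open>l\<close> in the link of \<open>w\<close> puts that whole link
  into the star of \<open>s\<close>, which is domination unless \<open>s = w\<close>.\<close>

lemma image_support:
  assumes "v \<in> V" "w \<in> V" "es v (\<Psi> (gen w)) \<noteq> 0" "es s (\<Phi> (gen v)) \<noteq> 0"
  shows "s = w"
proof -
  have "s \<in> V" using es_outside[OF \<Phi>_words] assms by force
  moreover have "lk E w \<subseteq> st E s" using image_support_star assms st_sym by blast
  ultimately show ?thesis using no_domination assms by blast
qed

text \<open>With only one nonzero entry left, the diagonal of the matrix product is a single product
  of two integers equal to 1, so the entry is 1 or -1.\<close>

lemma image_es:
  assumes "v \<in> V"
  shows "\<exists>w\<in>V. \<exists>b. (\<forall>z. es z (\<Phi> (gen v)) = (if z = w then if b then 1 else - 1 else 0))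
           \<and> (\<forall>z. es z (\<Psi> (gen w)) \<noteq> 0 \<longleftrightarrow> z = v)"
proof -
  interpret i: raag_aut V E \<Psi> \<Phi> by (rule inverse_aut)
  obtain w where w: "w \<in> V" "es w (\<Phi> (gen v)) \<noteq> 0" "es v (\<Psi> (gen w)) \<noteq> 0"
    using dual_generator assms by blast
  have 1: "es z (\<Phi> (gen v)) = 0" if "z \<noteq> w" for z using image_support assms w that by blast
  have 2: "es z (\<Psi> (gen w)) = 0" if "z \<noteq> v" for z using i.image_support assms w that by blast
  have "1 = es v (\<Psi> (\<Phi> (gen v)))" using eqv_es[OF \<Psi>_\<Phi>[of "gen v"], of v] assms by (simp add: sg_def)
  also have "\<dots> = (\<Sum>w\<in>V. es w (\<Phi> (gen v)) * es v (\<Psi> (gen w)))"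
    using assms by (intro i.es_\<Phi> \<Phi>_words) simp
  also have "\<dots> = es w (\<Phi> (gen v)) * es v (\<Psi> (gen w))"
    using w finite_V 1 by (subst sum.remove[of V w]) auto
  finally have "es w (\<Phi> (gen v)) = 1 \<or> es w (\<Phi> (gen v)) = - 1" by (metis zmult_eq_1_iff)
  then have "\<exists>b. es w (\<Phi> (gen v)) = (if b then 1 else - 1)" by metis
  then show ?thesis using w 1 2 by (metis (full_types))
qed

section \<open>Images of generators up to conjugacy\<close>

lemma conj_del_Int:
  assumes u: "u \<in> words" "g \<doteq> u @ del S g @ winv u"
    and v: "v \<in> words" "g \<doteq> v @ del T g @ winv v"
  shows "\<exists>k\<in>words. g \<doteq> k @ del (S \<inter> T) g @ winv k"
proof (intro bexI)
  have "del S g \<doteq> del S v @ del (S \<inter> T) g @ winv (del S v)"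
    using eqv_del[OF v(2), of S] by (simp add: del_winv)
  from eqv_context[OF this, of u "winv u"]
  show "g \<doteq> (u @ del S v) @ del (S \<inter> T) g @ winv (u @ del S v)" using u(2) eqv_trans by simp
  show "u @ del S v \<in> words" using u v by simp
qed

text \<open>Each \<open>l\<close> in the link of \<open>w\<close> has a dual generator
  \<open>m\<close> in the star of \<open>v\<close>. The image of \<open>m\<close> commutes with that
  of \<open>v\<close> and has nonzero exponent in \<open>l\<close>, so
  \<open>commute_conj_star\<close> moves the image of \<open>v\<close> into the star of
  \<open>l\<close>. A vertex in all these stars has a star containing the link of \<open>w\<close>,
  so only \<open>w\<close> survives the deletions.\<close>

lemma image_conj:
  assumes v: "v \<in> V" and w: "w \<in> V"
    and es: "\<And>z. es z (\<Phi> (gen v)) = (if z = w then if b then 1 else - 1 else 0)"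
    and nz: "es v (\<Psi> (gen w)) \<noteq> 0"
  shows "\<exists>k\<in>words. \<Phi> (gen v) \<doteq> k @ [(w, b)] @ winv k"
proof -
  interpret i: raag_aut V E \<Psi> \<Phi> by (rule inverse_aut)
  let ?g = "\<Phi> (gen v)"
  have g: "?g \<in> words" using v \<Phi>_words by simp
  have star: "\<exists>u\<in>words. ?g \<doteq> u @ del (st E l) ?g @ winv u" if l: "l \<in> lk E w" for l
  proof -
    have lV: "l \<in> V" and lw: "l \<noteq> w" using l lk_V lk_irrefl by auto
    obtain m where m: "m \<in> V" "es l (\<Phi> (gen m)) \<noteq> 0" "es m (\<Psi> (gen l)) \<noteq> 0"
      using i.dual_generator lV by blast
    \<comment> \<open>Otherwise the commuting \<Psi>-images of \<open>l\<close> and \<open>w\<close>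
      would give a vanishing minor at \<open>m\<close> and \<open>v\<close>, whose one product is
      nonzero and whose other product is 0.\<close>
    have "m \<in> st E v"
    proof (rule ccontr)
      assume c: "m \<notin> st E v"
      then have "{m, v} \<notin> E" "m \<noteq> v" by (auto simp: st_def lk_def insert_commute)
      moreover have "\<Psi> (gen l) @ \<Psi> (gen w) \<doteq> \<Psi> (gen w) @ \<Psi> (gen l)"
        using l w by (intro i.\<Phi>_gen_commute) (auto simp: st_def)
      ultimately have "es m (\<Psi> (gen l)) * es v (\<Psi> (gen w)) = es v (\<Psi> (gen l)) * es m (\<Psi> (gen w))"
        using commute_es by blast
      moreover have "es v (\<Psi> (gen l)) = 0" using i.image_support[of l m v] m lV \<open>m \<noteq> v\<close> by blast
      ultimately show False using nz m by simp
    qed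
    then have "?g @ \<Phi> (gen m) \<doteq> \<Phi> (gen m) @ ?g" using \<Phi>_gen_commute v eqv_sym by blast
    moreover have "es l ?g = 0" using es lw by simp
    ultimately show ?thesis using commute_conj_star[OF g \<Phi>_words, of "gen m" l] m by simp
  qed
  have all: "\<exists>u\<in>words. ?g \<doteq> u @ del (\<Inter>l\<in>L. st E l) ?g @ winv u"
    if "finite L" "L \<subseteq> lk E w" for L
    using that
  proof (induction L rule: finite_induct)
    case empty
    then show ?case by (intro bexI[of _ "[]"]) (simp_all add: del_id)
  next
    case (insert l L)
    then obtain u u' where "u \<in> words" "?g \<doteq> u @ del (\<Inter>l\<in>L. st E l) ?g @ winv u"
      "u' \<in> words" "?g \<doteq> u' @ del (st E l) ?g @ winv u'" using star by (metis insert_subset)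
    from conj_del_Int[OF this(3,4,1,2)] show ?case by simp
  qed
  have "finite (lk E w)" using lk_V finite_V finite_subset by blast
  then obtain u where u: "u \<in> words" "?g \<doteq> u @ del (\<Inter>l\<in>lk E w. st E l) ?g @ winv u"
    using all by blast
  have "s = w" if "s \<in> (\<Inter>l\<in>lk E w. st E l)" "s \<in> V" for s
    using that st_sym no_domination[OF w] by blast
  then have "del (\<Inter>l\<in>lk E w. st E l) ?g \<doteq> [(w, b)]"
    using g es[of w] by (intro single_letter_word) 
      (auto simp: set_del words_iff es_del st_def lk_sym)
  from eqv_context[OF this, of u "winv u"] show ?thesis using u eqv_trans by blast
qed

text \<open>The exponent support of the \<Psi>-image of \<open>\<pi> v\<close> recovers
  \<open>v\<close>, so \<pi> is injective and, \<open>V\<close> being finite, bijective. An edge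
  sent to a non-edge would violate the vanishing of minors.\<close>

theorem aut_permutes_generators_up_to_conj:
  "\<exists>\<pi> k \<epsilon>. bij_betw \<pi> V V \<and> (\<forall>u v. {u, v} \<in> E \<longrightarrow> {\<pi> u, \<pi> v} \<in> E)
     \<and> (\<forall>v\<in>V. \<Phi> (gen v) \<doteq> k v @ [(\<pi> v, \<epsilon> v)] @ winv (k v))"
proof -
  have "\<forall>v\<in>V. \<exists>w b k. w \<in> V \<and> \<Phi> (gen v) \<doteq> k @ [(w, b)] @ winv k
      \<and> (\<forall>z. es z (\<Phi> (gen v)) \<noteq> 0 \<longleftrightarrow> z = w) \<and> (\<forall>z. es z (\<Psi> (gen w)) \<noteq> 0 \<longleftrightarrow> z = v)"
  proof
    fix v assume v: "v \<in> V"
    from image_es[OF this] obtain w b where w: "w \<in> V"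
      "\<And>z. es z (\<Phi> (gen v)) = (if z = w then if b then 1 else - 1 else 0)"
      "\<And>z. es z (\<Psi> (gen w)) \<noteq> 0 \<longleftrightarrow> z = v" by blast
    obtain k where "\<Phi> (gen v) \<doteq> k @ [(w, b)] @ winv k"
      using image_conj[OF v w(1,2)] w(3) by blast
    then show "\<exists>w b k. w \<in> V \<and> \<Phi> (gen v) \<doteq> k @ [(w, b)] @ winv k
      \<and> (\<forall>z. es z (\<Phi> (gen v)) \<noteq> 0 \<longleftrightarrow> z = w) \<and> (\<forall>z. es z (\<Psi> (gen w)) \<noteq> 0 \<longleftrightarrow> z = v)"
      using w by (intro exI[of _ w] exI[of _ b] exI[of _ k]) auto
  qed
  then obtain \<pi> \<epsilon> k where *: "\<forall>v\<in>V. \<pi> v \<in> V \<and> \<Phi> (gen v) \<doteq> k v @ [(\<pi> v, \<epsilon> v)] @ winv (k v)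
      \<and> (\<forall>z. es z (\<Phi> (gen v)) \<noteq> 0 \<longleftrightarrow> z = \<pi> v) \<and> (\<forall>z. es z (\<Psi> (gen (\<pi> v))) \<noteq> 0 \<longleftrightarrow> z = v)"
    unfolding bchoice_iff by blast
  have inj: "inj_on \<pi> V"
  proof (rule inj_onI)
    fix u v assume "u \<in> V" "v \<in> V" "\<pi> u = \<pi> v"
    then have "\<forall>z. z = u \<longleftrightarrow> z = v" using * by metis
    then show "u = v" by blast
  qed
  moreover have "\<pi> ` V = V" using endo_inj_surj[OF finite_V _ inj] * by blast
  ultimately have "bij_betw \<pi> V V" by (simp add: bij_betw_def)
  moreover have "{\<pi> u, \<pi> v} \<in> E" if e: "{u, v} \<in> E" for u v
  proof (rule ccontr)
    assume c: "{\<pi> u, \<pi> v} \<notin> E"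
    have uv: "u \<in> V" "v \<in> V" "u \<noteq> v" using edgeD[OF e] by auto
    then have n: "\<pi> u \<noteq> \<pi> v" using inj by (auto dest: inj_onD)
    have "\<Phi> (gen u) @ \<Phi> (gen v) \<doteq> \<Phi> (gen v) @ \<Phi> (gen u)"
      using uv e by (intro \<Phi>_gen_commute) (auto simp: st_def lk_def insert_commute)
    from commute_es[OF this c n]
    have "es (\<pi> u) (\<Phi> (gen u)) * es (\<pi> v) (\<Phi> (gen v)) = es (\<pi> v) (\<Phi> (gen u)) * es (\<pi> u) (\<Phi> (gen v))" .
    moreover have "es (\<pi> u) (\<Phi> (gen u)) \<noteq> 0" "es (\<pi> v) (\<Phi> (gen v)) \<noteq> 0" using * uv by auto
    moreover have "es (\<pi> v) (\<Phi> (gen u)) = 0" using * uv n by metis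
    ultimately show False by simp
  qed
  ultimately show ?thesis using * by blast
qed

end

section \<open>Free groups\<close>

fun rcons :: "'v \<times> bool \<Rightarrow> ('v \<times> bool) list \<Rightarrow> ('v \<times> bool) list" where
  "rcons z [] = [z]"
| "rcons z (y # w) = (if y = linv z then w else z # y # w)"

definition nf :: "('v \<times> bool) list \<Rightarrow> ('v \<times> bool) list" where
  "nf w = foldr rcons w []"

fun reduced :: "('v \<times> bool) list \<Rightarrow> bool" where
  "reduced (z # y # w) \<longleftrightarrow> y \<noteq> linv z \<and> reduced (y # w)"
| "reduced _ \<longleftrightarrow> True"

lemma nf_simps [simp]: "nf [] = []" "nf (z # w) = rcons z (nf w)"
  by (simp_all add: nf_def)

lemma reduced_Cons: "reduced (z # w) \<longleftrightarrow> reduced w \<and> (w = [] \<or> hd w \<noteq> linv z)"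
  by (cases w) auto

lemma rcons_reduced: "reduced (z # w) \<Longrightarrow> rcons z w = z # w"
  by (cases w) auto

lemma reduced_rcons: "reduced w \<Longrightarrow> reduced (rcons z w)"
  by (cases w) (auto simp: reduced_Cons)

lemma reduced_nf [simp]: "reduced (nf w)"
  by (induction w) (auto intro: reduced_rcons)

lemma nf_reduced: "reduced w \<Longrightarrow> nf w = w"
  by (induction w) (auto simp: reduced_Cons rcons_reduced)

text \<open>Van der Waerden's trick: letters act on reduced words by bijections, inverse letters by
  inverse bijections. Well-definedness of the normal form rests on this.\<close>

lemma rcons_rcons_linv [simp]:
  assumes "reduced w" shows "rcons z (rcons (linv z) w) = w"
proof (cases w)
  case (Cons y v)
  show ?thesis
  proof (cases "y = z")
    case True
    then show ?thesis using assms Cons by (auto simp: rcons_reduced)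
  qed (use Cons in auto)
qed simp

lemma nf_append: "nf (a @ b) = foldr rcons a (nf b)"
  by (simp add: nf_def)

text \<open>A word and its normal form act in the same way on reduced words.\<close>

lemma nf_append_cong: "nf a = nf a' \<Longrightarrow> nf b = nf b' \<Longrightarrow> nf (a @ b) = nf (a' @ b')"
proof -
  have *: "foldr rcons (rcons z v) r = rcons z (foldr rcons v r)" if "reduced r" for z v and r :: "('v \<times> bool) list"
  proof (cases v)
    case (Cons y u)
    have "reduced (foldr rcons u r)"
      using that by (induction u) (auto intro: reduced_rcons)
    then have "rcons z (rcons (linv z) (foldr rcons u r)) = foldr rcons u r"
      by (rule rcons_rcons_linv)
    then show ?thesis using Cons by auto
  qed simp
  have "foldr rcons (nf a) r = foldr rcons a r" if "reduced r" for a and r :: "('v \<times> bool) list"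
    using that by (induction a) (simp_all add: *)
  then show "nf a = nf a' \<Longrightarrow> nf b = nf b' \<Longrightarrow> nf (a @ b) = nf (a' @ b')"
    unfolding nf_append by (metis reduced_nf)
qed

lemma nf_nf [simp]: "nf (nf w) = nf w"
  by (simp add: nf_reduced)

lemma nf_context: "nf a = nf a' \<Longrightarrow> nf (p @ a @ q) = nf (p @ a' @ q)"
  by (intro nf_append_cong refl)

lemma nf_cancel_letter: "nf (p @ [z, linv z] @ q) = nf (p @ q)"
  using nf_context[of "[z, linv z]" "[]" p q] by simp

lemma nf_right_inv: "nf (w @ winv w) = []"
proof (induction w)
  case (Cons z w)
  have "nf ([z] @ (w @ winv w) @ [linv z]) = nf ([z] @ [] @ [linv z])"
    using Cons by (intro nf_context) simp
  then show ?case by (simp add: winv_Cons)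
qed simp

lemma nf_left_inv: "nf (winv w @ w) = []"
  using nf_right_inv[of "winv w"] by simp

lemma nf_cancel: "nf (p @ w @ winv w @ q) = nf (p @ q)" "nf (p @ winv w @ w @ q) = nf (p @ q)"
  using nf_context[of "w @ winv w" "[]" p q] nf_context[of "winv w @ w" "[]" p q]
  by (simp_all add: nf_right_inv nf_left_inv)

lemma nf_move_left: "nf (w @ a) = nf b \<Longrightarrow> nf a = nf (winv w @ b)"
  using nf_append_cong[of "winv w" "winv w" "w @ a" b] nf_cancel(2)[of "[]" w a] by simp

lemma nf_winv_cong:
  assumes "nf a = nf b" shows "nf (winv a) = nf (winv b)"
proof -
  have "nf (a @ winv b) = nf []"
    using nf_append_cong[OF assms refl, of "winv b"] by (simp add: nf_right_inv)
  from nf_move_left[OF this] show ?thesis by simp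
qed

lemma reduced_append:
  "reduced (a @ b) \<longleftrightarrow> reduced a \<and> reduced b \<and> (a = [] \<or> b = [] \<or> hd b \<noteq> linv (last a))"
  by (induction a) (auto simp: reduced_Cons hd_append)

lemma reduced_winv: "reduced w \<Longrightarrow> reduced (winv w)"
  by (induction w) (auto simp: reduced_Cons winv_Cons reduced_append winv_def last_rev hd_map)

lemma set_rcons: "set (rcons z w) \<subseteq> insert z (set w)"
  by (cases w) auto

lemma set_nf: "set (nf w) \<subseteq> set w"
  by (induction w) (use set_rcons in fastforce)+

text \<open>The tripod of two reduced words: \<open>c\<close> is the arm that cancels. The bounded
  defect of counting functions comes from this decomposition.\<close>

lemma reduced_product:
  assumes "reduced r" "reduced s"
  shows "\<exists>a b c. r = a @ c \<and> s = winv c @ b \<and> reduced (a @ b)"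
  using assms
proof (induction r arbitrary: s rule: rev_induct)
  case (snoc z r)
  show ?case
  proof (cases "s \<noteq> [] \<and> hd s = linv z")
    case True
    then obtain s' where s: "s = linv z # s'" by (cases s) auto
    then obtain a b c where "r = a @ c" "s' = winv c @ b" "reduced (a @ b)"
      using snoc by (metis reduced_append reduced_Cons)
    then have "r @ [z] = a @ (c @ [z]) \<and> s = winv (c @ [z]) @ b \<and> reduced (a @ b)"
      using s by simp
    then show ?thesis by blast
  next
    case False
    then have "r @ [z] = (r @ [z]) @ [] \<and> s = winv [] @ s \<and> reduced ((r @ [z]) @ s)"
      using snoc.prems by (auto simp: reduced_append reduced_Cons)
    then show ?thesis by blast
  qed
qed auto

lemma nf_map:
  assumes "inj_on s A" "\<And>z. z \<in> A \<Longrightarrow> linv z \<in> A \<and> s (linv z) = linv (s z)" "set w \<subseteq> A"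
  shows "nf (map s w) = map s (nf w)"
  using assms(3)
proof (induction w)
  case (Cons z w)
  have "rcons (s z) (map s r) = map s (rcons z r)" if "set r \<subseteq> A" for r
    using that assms(1,2) Cons.prems by (cases r) (auto simp: inj_on_def)
  then show ?case using Cons set_nf[of w] by auto
qed simp

text \<open>The reduced words of the subgroup generated by \<open>x\<close> and \<open>c y c\<^sup>-\<^sup>1\<close> when \<open>c\<close> starts with a power
  of \<open>y\<close> and ends with a power of \<open>x\<close>; \<open>inner\<close> describes what follows an initial \<open>c\<close>.\<close>

inductive outer inner :: "'v \<Rightarrow> 'v \<Rightarrow> ('v \<times> bool) list \<Rightarrow> ('v \<times> bool) list \<Rightarrow> bool" for x y c where
  outer_Nil: "outer x y c []"
| outer_x: "outer x y c w \<Longrightarrow> w = [] \<or> hd w \<noteq> (x, \<not> b) \<Longrightarrow> outer x y c ((x, b) # w)"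
| outer_c: "inner x y c w \<Longrightarrow> outer x y c (c @ w)"
| inner_out: "outer x y c w \<Longrightarrow> w = [] \<or> fst (hd w) = x \<Longrightarrow> inner x y c ((y, b) # winv c @ w)"
| inner_y: "inner x y c ((y, b) # w) \<Longrightarrow> inner x y c ((y, b) # (y, b) # w)"

context
  fixes x y :: 'v and c :: "('v \<times> bool) list"
  assumes xy: "x \<noteq> y" and red: "reduced c" and ne: "c \<noteq> []"
    and hd_c: "fst (hd c) = y" and last_c: "fst (last c) = x"
begin

lemma inner_hd: "inner x y c w \<Longrightarrow> \<exists>b v. w = (y, b) # v"
  by (erule inner.cases) auto

text \<open>At every seam an \<open>x\<close>-letter meets a \<open>y\<close>-letter, because of the
  first and last letters prescribed for \<open>c\<close>.\<close>

lemma outer_inner_reduced: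
  "outer x y c w \<Longrightarrow> reduced w"
  "inner x y c w \<Longrightarrow> reduced w"
proof (induction rule: outer_inner.inducts)
  case (outer_c w)
  then show ?case using red last_c xy inner_hd[of w] by (auto simp: reduced_append linv_def)
next
  case (inner_out w b)
  have "reduced (winv c)" using red by (rule reduced_winv)
  moreover have "fst (last (winv c)) = y" "fst (hd (winv c)) = x"
    using ne hd_c last_c by (simp_all add: winv_def last_rev hd_rev hd_map last_map)
  ultimately show ?case using inner_out xy ne
    by (auto simp: reduced_append reduced_Cons linv_def)
qed (auto simp: reduced_Cons linv_def)

lemma outer_mult_x: "outer x y c w \<Longrightarrow> outer x y c (rcons (x, b) w)"
proof (cases w)
  case (Cons z v)
  assume o: "outer x y c w"
  show ?thesis
  proof (cases "z = (x, \<not> b)")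
    case True
    \<comment> \<open>Only \<open>outer_x\<close> can have produced \<open>w\<close>, since a word
      made by \<open>outer_c\<close> starts with the \<open>y\<close>-letter at the head of
      \<open>c\<close>.\<close>
    from o have "outer x y c v"
      by (cases rule: outer.cases) (use True Cons hd_c ne xy in \<open>auto simp: hd_append Cons_eq_append_conv\<close>)
    then show ?thesis using Cons True by (simp add: linv_def)
  next
    case False
    then show ?thesis using o Cons outer_x[of x y c w b] by (auto simp: linv_def)
  qed
qed (auto intro: outer_x[of x y c "[]" b, simplified] outer_Nil)

text \<open>If \<open>w\<close> starts with \<open>c\<close>, the copies of \<open>c\<close> cancel
  and the new \<open>y\<close>-letter meets a power of \<open>y\<close>. That power grows, shrinks,
  or disappears; in the last case the surrounding \<open>c\<close> and its inverse cancel too.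
  Otherwise a new syllable opens in front of \<open>w\<close>.\<close>

lemma outer_mult_y:
  assumes o: "outer x y c w" shows "outer x y c (nf (c @ [(y, b)] @ winv c @ w))"
proof -
  have red_w: "reduced w" using outer_inner_reduced(1) o by blast
  have new: ?thesis if "w = [] \<or> fst (hd w) = x"
  proof -
    have "outer x y c (c @ (y, b) # winv c @ w)" using o that by (intro outer_c inner_out)
    then show ?thesis using outer_inner_reduced(1) nf_reduced by fastforce
  qed
  from o show ?thesis
  proof (cases rule: outer.cases)
    case (outer_c v)
    obtain e u where v: "v = (y, e) # u" using outer_c inner_hd by blast
    have eq: "nf (c @ [(y, b)] @ winv c @ w) = nf (c @ (y, b) # v)"
      using nf_cancel(2)[of "c @ [(y, b)]" c v] outer_c by simp
    show ?thesis
    proof (cases "e = b")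
      case True
      then have "outer x y c (c @ (y, b) # v)"
        using outer_c v by (intro outer_inner.outer_c) (auto intro: inner_y)
      then show ?thesis unfolding eq using outer_inner_reduced(1) nf_reduced by metis
    next
      case False
      then have e: "e = (\<not> b)" by simp
      have cu: "nf (c @ (y, b) # v) = nf (c @ u)"
        using nf_cancel_letter[of c "(y, b)" u] v e by (simp add: linv_def)
      from outer_c(2) show ?thesis
      proof (cases rule: inner.cases)
        case (inner_out r e')
        then have "u = winv c @ r" using v by simp
        then have "nf (c @ u) = r"
          using nf_cancel(1)[of "[]" c r] nf_reduced outer_inner_reduced(1) inner_out by auto
        then show ?thesis using eq cu inner_out by simp
      next
        case (inner_y e' r)
        then have "outer x y c (c @ u)" using v by (intro outer_inner.outer_c) simp
        then show ?thesis using eq cu outer_inner_reduced(1) nf_reduced by metis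
      qed
    qed
  qed (use new in auto)
qed

lemma outer_subst:
  assumes "fst ` set w \<subseteq> {x, y}"
  shows "outer x y c (nf (concat (map (\<lambda>z. if fst z = x then [z] else c @ [z] @ winv c) w)))"
  using assms
proof (induction w)
  case (Cons z w)
  let ?\<tau> = "\<lambda>z. if fst z = x then [z] else c @ [z] @ winv c"
  let ?r = "nf (concat (map ?\<tau> w))"
  have o: "outer x y c ?r" using Cons by simp
  have *: "nf (concat (map ?\<tau> (z # w))) = nf (?\<tau> z @ ?r)"
    using nf_append_cong[of "?\<tau> z" "?\<tau> z" "concat (map ?\<tau> w)" ?r] by (simp only: list.map concat.simps nf_nf)
  show ?case
  proof (cases "fst z = x")
    case True
    then show ?thesis unfolding * using outer_mult_x[OF o, of "snd z"] by (cases z) simp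
  next
    case False
    then have "z = (y, snd z)" using Cons.prems by (cases z) auto
    then show ?thesis unfolding * using outer_mult_y[OF o, of "snd z"] False by simp
  qed
qed (simp add: outer_Nil)

text \<open>Together with \<open>outer_subst\<close> this shows that \<open>y\<close> is not in the
  subgroup generated by \<open>x\<close> and its companion conjugate of \<open>y\<close>.\<close>

lemma not_outer_y: "\<not> outer x y c [(y, b)]"
proof
  assume "outer x y c [(y, b)]"
  then show False
  proof (cases rule: outer.cases)
    case (outer_c w)
    have "length (c @ w) \<ge> 2" using inner_hd[OF outer_c(2)] ne by (cases c) auto
    then show False using outer_c by (metis One_nat_def Suc_1 length_Cons list.size(3) not_less_eq_eq order_refl)
  qed (use xy in auto)
qed

end

text \<open>Powers of \<open>x\<close> on the left commute with \<open>x\<close> and powers of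
  \<open>y\<close> on the right commute with \<open>y\<close>. Only the middle part \<open>d\<close>
  obstructs a common conjugator.\<close>

lemma strip_powers:
  assumes "fst ` set c \<subseteq> {x, y}"
  shows "\<exists>p d q. c = p @ d @ q \<and> fst ` set p \<subseteq> {x} \<and> fst ` set q \<subseteq> {y}
           \<and> (d = [] \<or> fst (hd d) = y \<and> fst (last d) = x)"
proof -
  let ?P = "\<lambda>z. fst z = x" and ?Q = "\<lambda>z. fst z = y"
  define p e where "p = takeWhile ?P c" and "e = dropWhile ?P c"
  define q d where "q = rev (takeWhile ?Q (rev e))" and "d = rev (dropWhile ?Q (rev e))"
  have e: "e = d @ q" unfolding q_def d_def by (metis rev_append rev_rev_ident takeWhile_dropWhile_id)
  have c: "c = p @ d @ q" using e takeWhile_dropWhile_id[of ?P c] by (simp add: p_def e_def)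
  have "fst ` set p \<subseteq> {x}" by (auto simp: p_def dest: set_takeWhileD)
  moreover have "fst ` set q \<subseteq> {y}" by (auto simp: q_def dest: set_takeWhileD)
  moreover have "fst (hd d) = y \<and> fst (last d) = x" if "d \<noteq> []"
  proof -
    have "\<not> ?P (hd e)" using that e hd_dropWhile[of ?P c] by (auto simp: e_def)
    then have "fst (hd d) \<noteq> x" using that e by (simp add: hd_append)
    moreover have "\<not> ?Q (hd (dropWhile ?Q (rev e)))" using that hd_dropWhile[of ?Q "rev e"] by (simp add: d_def)
    then have "fst (last d) \<noteq> y" using that by (simp add: d_def last_rev)
    moreover have "hd d \<in> set c" "last d \<in> set c" using c that by auto
    then have "fst (hd d) \<in> {x, y}" "fst (last d) \<in> {x, y}" using assms by blast+
    ultimately show ?thesis by auto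
  qed
  ultimately show ?thesis using c by metis
qed

section \<open>Simultaneous conjugation of two free generators\<close>

lemma nf_concat_conj:
  assumes "\<And>z. z \<in> set w \<Longrightarrow> nf (\<sigma> z) = nf (k @ \<tau> z @ winv k)"
  shows "nf (concat (map \<sigma> w)) = nf (k @ concat (map \<tau> w) @ winv k)"
  using assms
proof (induction w)
  case Nil
  then show ?case by (simp add: nf_right_inv)
next
  case (Cons z w)
  have "nf (concat (map \<sigma> (z # w))) = nf ((k @ \<tau> z @ winv k) @ (k @ concat (map \<tau> w) @ winv k))"
    unfolding list.map concat.simps using Cons by (intro nf_append_cong) auto
  also have "\<dots> = nf (k @ concat (map \<tau> (z # w)) @ winv k)"
    using nf_cancel(2)[of "k @ \<tau> z" k "concat (map \<tau> w) @ winv k"] by simp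
  finally show ?case .
qed

lemma nf_conj_power:
  assumes "fst ` set p \<subseteq> {fst z}"
  shows "nf (p @ [z] @ winv p) = [z]"
proof -
  have "nf (p @ [z]) = nf ([z] @ p)"
    using assms
  proof (induction p)
    case (Cons y p)
    then have "y = z \<or> y = linv z" by (cases y; cases z) (auto simp: linv_def)
    moreover have "rcons (linv z) (rcons z (nf p)) = nf p"
      using rcons_rcons_linv[of "nf p" "linv z"] by simp
    ultimately show ?case using Cons by auto
  qed simp
  then have "nf ((p @ [z]) @ winv p) = nf (([z] @ p) @ winv p)" by (rule nf_append_cong) simp
  then show ?thesis using nf_cancel(1)[of "[z]" p "[]"] by simp
qed

lemma generating_conjugates:
  assumes xy: "x \<noteq> y" and a: "fst ` set a \<subseteq> {x, y}" and b: "fst ` set b \<subseteq> {x, y}"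
    and \<sigma>: "\<And>z. \<sigma> z = (if fst z = x then a @ [z] @ winv a else b @ [z] @ winv b)"
    and surj: "\<And>t. fst ` set t \<subseteq> {x, y} \<Longrightarrow>
                 \<exists>w. fst ` set w \<subseteq> {x, y} \<and> nf (concat (map \<sigma> w)) = nf t"
  shows "\<exists>k. fst ` set k \<subseteq> {x, y} \<and>
           (\<forall>z. fst z \<in> {x, y} \<longrightarrow> nf (\<sigma> z) = nf (k @ [z] @ winv k))"
proof -
  define c where "c = nf (winv a @ b)"
  have "fst ` set c \<subseteq> fst ` (linv ` set a \<union> set b)"
    using set_nf[of "winv a @ b"] by (intro image_mono) (simp add: c_def set_winv)
  also have "\<dots> \<subseteq> {x, y}" using a b by (simp add: image_Un image_image)
  finally have c: "reduced c" "fst ` set c \<subseteq> {x, y}" by (simp_all add: c_def)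
  obtain p d q where pdq: "c = p @ d @ q" "fst ` set p \<subseteq> {x}" "fst ` set q \<subseteq> {y}"
    "d = [] \<or> fst (hd d) = y \<and> fst (last d) = x" using strip_powers[OF c(2)] by blast
  \<comment> \<open>Since \<open>b\<close> equals \<open>a p d q\<close>, with \<open>p\<close> and
    \<open>q\<close> powers of \<open>x\<close> and \<open>y\<close>, conjugating by
    \<open>k\<close> turns \<open>x\<close> and \<open>d y d^-1\<close> into the two given
    conjugates.\<close>
  define k where "k = a @ p"
  have k: "fst ` set k \<subseteq> {x, y}" using a pdq by (auto simp: k_def)
  let ?\<tau> = "\<lambda>z. if fst z = x then [z] else d @ [z] @ winv d"
  have \<sigma>\<tau>: "nf (\<sigma> z) = nf (k @ ?\<tau> z @ winv k)" if z: "fst z \<in> {x, y}" for z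
  proof (cases "fst z = x")
    case True
    then have "nf (a @ (p @ [z] @ winv p) @ winv a) = nf (a @ [z] @ winv a)"
      using pdq nf_conj_power[of p z] by (intro nf_context) auto
    then show ?thesis using True by (simp add: \<sigma> k_def)
  next
    case False
    have "nf (a @ c) = nf (a @ winv a @ b)" unfolding c_def by (intro nf_append_cong) simp_all
    then have *: "nf b = nf (a @ c)" using nf_cancel(1)[of "[]" a b] by simp
    have "nf (b @ [z] @ winv b) = nf ((a @ c) @ [z] @ winv (a @ c))"
      using * by (intro nf_append_cong nf_winv_cong refl)
    also have "\<dots> = nf ((a @ p @ d) @ (q @ [z] @ winv q) @ winv (a @ p @ d))" using pdq by simp
    also have "\<dots> = nf ((a @ p @ d) @ [z] @ winv (a @ p @ d))"
      using pdq nf_conj_power[of q z] z False by (intro nf_context) auto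
    finally show ?thesis using False by (simp add: \<sigma> k_def)
  qed
  have "d = []"
  proof (rule ccontr)
    \<comment> \<open>Surjectivity reaches \<open>k y k^-1\<close>; undoing the conjugation by
      \<open>k\<close> places \<open>y\<close> in the subgroup generated by \<open>x\<close> and
      \<open>d y d^-1\<close>.\<close>
    assume d: "d \<noteq> []"
    have "fst ` set (k @ [(y, True)] @ winv k) \<subseteq> {x, y}" using k by (auto simp: set_winv)
    then obtain w where w: "fst ` set w \<subseteq> {x, y}"
      "nf (concat (map \<sigma> w)) = nf (k @ [(y, True)] @ winv k)" using surj by blast
    have "nf (k @ concat (map ?\<tau> w) @ winv k) = nf (k @ [(y, True)] @ winv k)"
      using nf_concat_conj[of w \<sigma> k ?\<tau>] \<sigma>\<tau> w by fastforce
    then have "nf (winv k @ (k @ concat (map ?\<tau> w) @ winv k) @ k)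
        = nf (winv k @ (k @ [(y, True)] @ winv k) @ k)" by (rule nf_context)
    then have "nf (concat (map ?\<tau> w)) = [(y, True)]"
      using nf_cancel(2)[of "[]" k] nf_cancel(2)[of _ k "[]"] by (simp add: nf_left_inv)
    moreover have "reduced d" using c pdq by (simp add: reduced_append)
    ultimately show False using outer_subst[OF xy _ d _ _ w(1)] not_outer_y[OF xy _ d] pdq d by metis
  qed
  then have "nf (\<sigma> z) = nf (k @ [z] @ winv k)" if "fst z \<in> {x, y}" for z
    using \<sigma>\<tau>[OF that] by simp
  then show ?thesis using k by blast
qed

section \<open>Counting quasimorphisms\<close>

text \<open>An occurrence is recorded by the prefix in front of it, so overlapping occurrences are
  counted separately.\<close>

definition occ :: "'a list \<Rightarrow> 'a list \<Rightarrow> 'a list set" where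
  "occ u w = {p. \<exists>q. w = p @ u @ q}"

definition cnt :: "'a list \<Rightarrow> 'a list \<Rightarrow> nat" where
  "cnt u w = card (occ u w)"

lemma finite_occ [simp]: "finite (occ u w)"
proof -
  have "occ u w \<subseteq> (\<lambda>i. take i w) ` {..length w}"
  proof
    fix p assume "p \<in> occ u w"
    then have "p = take (length p) w" "length p \<le> length w" by (auto simp: occ_def)
    then show "p \<in> (\<lambda>i. take i w) ` {..length w}" by blast
  qed
  then show ?thesis by (rule finite_subset) simp
qed

lemma occ_length_inj: "p \<in> occ u w \<Longrightarrow> p' \<in> occ u' w \<Longrightarrow> length p = length p' \<Longrightarrow> p = p'"
  by (auto simp: occ_def)

lemma occ_length: "p \<in> occ u w \<Longrightarrow> length p + length u \<le> length w"
  by (auto simp: occ_def)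

lemma cnt_eq_0: "(\<And>p q. w \<noteq> p @ u @ q) \<Longrightarrow> cnt u w = 0"
  by (simp add: cnt_def occ_def)

lemma cnt_eq_0_set: "\<not> set u \<subseteq> set w \<Longrightarrow> cnt u w = 0"
  by (rule cnt_eq_0) auto

lemma cnt_append_ge:
  assumes "u \<noteq> []" shows "cnt u a + cnt u b \<le> cnt u (a @ b)"
proof -
  have "cnt u a + cnt u b = card (occ u a) + card ((@) a ` occ u b)"
    by (simp add: cnt_def card_image inj_on_def)
  also have "\<dots> = card (occ u a \<union> (@) a ` occ u b)"
    using assms by (intro card_Un_disjoint[symmetric]) (simp, simp, auto simp: occ_def)
  also have "\<dots> \<le> cnt u (a @ b)"
    unfolding cnt_def by (intro card_mono) (simp, auto simp: occ_def)
  finally show ?thesis .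
qed

lemma cnt_append_le: "cnt u (a @ b) \<le> cnt u a + cnt u b + length u"
proof -
  \<comment> \<open>Starting positions of the occurrences that straddle the seam: at most
    \<open>length u\<close> of them.\<close>
  let ?I = "{length a - length u..<length a}"
  have "occ u (a @ b) \<subseteq> occ u a \<union> (@) a ` occ u b \<union> (\<lambda>i. take i (a @ b)) ` ?I"
  proof
    fix p assume "p \<in> occ u (a @ b)"
    then obtain q where q: "a @ b = p @ u @ q" by (auto simp: occ_def)
    consider "length p + length u \<le> length a" | "length a \<le> length p"
      | "length a < length p + length u" "length p < length a" by linarith
    then show "p \<in> occ u a \<union> (@) a ` occ u b \<union> (\<lambda>i. take i (a @ b)) ` ?I"
    proof cases
      case 1
      have "a = take (length a) (p @ u @ q)" using q by (metis append_eq_conv_conj)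
      also have "\<dots> = p @ u @ take (length a - length p - length u) q" using 1 by simp
      finally show ?thesis by (auto simp: occ_def)
    next
      case 2
      have "p = a @ drop (length a) p" using q 2
        by (metis append_eq_append_conv_if append_take_drop_id)
      moreover from this have "b = drop (length a) p @ u @ q" using q
        by (metis append.assoc same_append_eq)
      ultimately show ?thesis by (auto simp: occ_def)
    next
      case 3
      have "p = take (length p) (a @ b)" using q by simp
      then show ?thesis using 3 by (intro UnI2 image_eqI[of _ _ "length p"]) auto
    qed
  qed
  then have "cnt u (a @ b) \<le> card (occ u a \<union> (@) a ` occ u b \<union> (\<lambda>i. take i (a @ b)) ` ?I)"
    unfolding cnt_def by (intro card_mono) auto
  also have "\<dots> \<le> card (occ u a) + card ((@) a ` occ u b) + card ((\<lambda>i. take i (a @ b)) ` ?I)"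
    by (meson add_le_mono card_Un_le le_trans order_refl)
  also have "card ((@) a ` occ u b) = cnt u b" by (simp add: cnt_def card_image inj_on_def)
  also have "card ((\<lambda>i. take i (a @ b)) ` ?I) \<le> length u"
    using card_image_le[of ?I "\<lambda>i. take i (a @ b)"] by simp
  finally show ?thesis by (simp add: cnt_def)
qed

lemma cnt_winv: "cnt u (winv w) = cnt (winv u) w"
proof -
  have le: "cnt (winv u) w \<le> cnt u (winv w)" for u w :: "('a \<times> bool) list"
  proof -
    let ?f = "\<lambda>p. winv (drop (length p + length u) w)"
    have "inj_on ?f (occ (winv u) w)"
    proof (rule inj_onI)
      fix p p' assume p: "p \<in> occ (winv u) w" "p' \<in> occ (winv u) w" and "?f p = ?f p'"
      then have "length (?f p) = length (?f p')" by simp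
      moreover have "length p + length u \<le> length w" "length p' + length u \<le> length w"
        using p[THEN occ_length] by simp_all
      ultimately show "p = p'" using occ_length_inj[OF p] by simp
    qed
    moreover have "?f ` occ (winv u) w \<subseteq> occ u (winv w)" by (auto simp: occ_def)
    ultimately show ?thesis unfolding cnt_def by (intro card_inj_on_le) auto
  qed
  show ?thesis using le[of u w] le[of "winv u" "winv w"] by simp
qed

lemma cnt_map:
  assumes "inj_on s A" "set u \<subseteq> A" "set w \<subseteq> A"
  shows "cnt (map s u) (map s w) = cnt u w"
proof -
  have "occ (map s u) (map s w) = map s ` occ u w"
  proof (intro equalityI subsetI)
    fix p assume "p \<in> occ (map s u) (map s w)"
    then obtain p' m q where w: "w = p' @ m @ q" and m: "map s m = map s u" "p = map s p'"
      by (force simp: occ_def map_eq_append_conv append_eq_map_conv)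
    have "inj_on s (set m \<union> set u)" using assms w by (auto intro: inj_on_subset)
    then have "m = u" using m inj_on_map_eq_map by blast
    then show "p \<in> map s ` occ u w" using w m by (auto simp: occ_def)
  qed (auto simp: occ_def)
  moreover have "inj_on (map s) (occ u w)"
  proof (rule inj_onI)
    fix p p' assume "p \<in> occ u w" "p' \<in> occ u w" "map s p = map s p'"
    then show "p = p'" using occ_length_inj by (metis length_map)
  qed
  ultimately show ?thesis by (simp add: cnt_def card_image)
qed

section \<open>Brooks counting functions\<close>

definition brooks :: "('v \<times> bool) list \<Rightarrow> ('v \<times> bool) list \<Rightarrow> real" where
  "brooks u r = real (cnt u r) - real (cnt (winv u) r)"

lemma brooks_winv: "brooks u (winv r) = - brooks u r"
  by (simp add: brooks_def cnt_winv)

lemma brooks_append: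
  assumes "u \<noteq> []"
  shows "\<bar>brooks u (a @ b) - brooks u a - brooks u b\<bar> \<le> length u"
  using cnt_append_le[of u a b] cnt_append_ge[OF assms, of a b]
    cnt_append_le[of "winv u" a b] cnt_append_ge[of "winv u" a b] assms
  by (simp add: brooks_def)

text \<open>The contributions of the cancelled arm and its inverse are opposite. Each of the three
  seams of the tripod costs at most \<open>length u\<close>.\<close>

lemma brooks_product:
  assumes "u \<noteq> []"
  shows "\<bar>brooks u (nf r) + brooks u (nf s) - brooks u (nf (r @ s))\<bar> \<le> 3 * length u"
proof -
  obtain a b c where rs: "nf r = a @ c" "nf s = winv c @ b" "reduced (a @ b)"
    using reduced_product[OF reduced_nf reduced_nf] by metis
  have "nf (r @ s) = nf (nf r @ nf s)" by (intro nf_append_cong) simp_all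
  also have "\<dots> = nf (a @ b)" using rs nf_cancel(1)[of a c b] by simp
  also have "\<dots> = a @ b" using rs nf_reduced by blast
  finally have "nf (r @ s) = a @ b" .
  then show ?thesis
    using brooks_append[OF assms, of a c] brooks_append[OF assms, of "winv c" b]
      brooks_append[OF assms, of a b] by (simp add: rs brooks_winv)
qed

text \<open>The runs of \<open>x\<close> between successive \<open>y\<close>-letters have lengths 2
  and \<open>i + 3\<close>. They are unequal and at least 2, so on the test words the pattern
  differs from its inverse, from its variant with \<open>x\<close> and \<open>y\<close> exchanged,
  and for different \<open>i\<close>. Its length is \<open>i + 8\<close>.\<close>

definition pattern :: "nat \<Rightarrow> 'v \<Rightarrow> 'v \<Rightarrow> bool \<Rightarrow> bool \<Rightarrow> ('v \<times> bool) list" where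
  "pattern i x y e d = [(y, d), (x, e), (x, e), (y, d)] @ replicate (i + 3) (x, e) @ [(y, d)]"

text \<open>Summing over the signs makes the counting function invariant under inverting generators.\<close>

definition sym_count :: "nat \<Rightarrow> 'v \<Rightarrow> 'v \<Rightarrow> ('v \<times> bool) list \<Rightarrow> real" where
  "sym_count i x y w = (\<Sum>e\<in>UNIV. \<Sum>d\<in>UNIV. brooks (pattern i x y e d) (nf w))"

lemma sym_count_cong: "nf a = nf b \<Longrightarrow> sym_count i x y a = sym_count i x y b"
  by (simp add: sym_count_def)

text \<open>Four choices of signs, each with defect at most three times the pattern length.\<close>

lemma sym_count_quasi:
  "\<bar>sym_count i x y a + sym_count i x y b - sym_count i x y (a @ b)\<bar> \<le> 12 * real (i + 8)"
proof -
  have "\<bar>brooks (pattern i x y e d) (nf a) + brooks (pattern i x y e d) (nf b)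
      - brooks (pattern i x y e d) (nf (a @ b))\<bar> \<le> 3 * real (i + 8)" for e d
    using brooks_product[of "pattern i x y e d" a b] by (simp add: pattern_def)
  from this[of True True] this[of True False] this[of False True] this[of False False]
  show ?thesis by (simp add: sym_count_def UNIV_bool)
qed

lemma nf_winv: "nf (winv w) = winv (nf w)"
  using nf_winv_cong[of w "nf w"] nf_reduced[OF reduced_winv[OF reduced_nf]] by simp

lemma sym_count_winv: "sym_count i x y (winv w) = - sym_count i x y w"
  by (simp add: sym_count_def nf_winv brooks_winv sum_negf)

lemma sym_count_conj:
  assumes "nf w = nf (k @ v @ winv k)"
  shows "\<bar>sym_count i x y w - sym_count i x y v\<bar> \<le> 24 * real (i + 8)"
  using sym_count_quasi[of i x y k "v @ winv k"] sym_count_quasi[of i x y v "winv k"]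
    sym_count_cong[OF assms, of i x y] by (simp add: sym_count_winv)

text \<open>A relabelling injective on signed letters and compatible with inversion commutes with
  reduction and preserves counts. The sign changes prescribed by \<epsilon> only permute the four
  summands.\<close>

lemma sym_count_map:
  assumes xy: "x \<noteq> y" and s: "\<And>v b. v \<in> {x, y} \<Longrightarrow> s (v, b) = (\<pi> v, b = \<epsilon> v)"
    and \<pi>: "\<pi> x \<noteq> \<pi> y" and w: "fst ` set w \<subseteq> {x, y}"
  shows "sym_count i (\<pi> x) (\<pi> y) (map s w) = sym_count i x y w"
proof -
  define A where "A = {x, y} \<times> (UNIV :: bool set)"
  have wA: "set w \<subseteq> A" using w by (auto simp: A_def)
  have inj: "inj_on s A" using s \<pi> by (fastforce simp: inj_on_def A_def)
  have lin: "linv z \<in> A \<and> s (linv z) = linv (s z)" if "z \<in> A" for z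
    using that s by (auto simp: A_def linv_def)
  have pA: "set (pattern i x y e d) \<subseteq> A" for e d by (auto simp: pattern_def A_def)
  have winv_map: "map s (winv u) = winv (map s u)" if "set u \<subseteq> A" for u
    using that lin by (auto simp: winv_def rev_map)
  have "brooks (pattern i (\<pi> x) (\<pi> y) (e = \<epsilon> x) (d = \<epsilon> y)) (nf (map s w))
      = brooks (pattern i x y e d) (nf w)" for e d
  proof -
    let ?u = "pattern i x y e d"
    have "pattern i (\<pi> x) (\<pi> y) (e = \<epsilon> x) (d = \<epsilon> y) = map s ?u"
      using s by (simp add: pattern_def)
    moreover have "nf (map s w) = map s (nf w)" using nf_map[OF inj lin wA] .
    moreover have "set (nf w) \<subseteq> A" using set_nf[of w] wA by blast
    moreover have "set (winv ?u) \<subseteq> A" using pA[of e d] lin by (auto simp: set_winv)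
    ultimately show ?thesis
      using cnt_map[OF inj] pA[of e d] by (simp add: brooks_def flip: winv_map)
  qed
  from this[of True True] this[of True False] this[of False True] this[of False False]
  show ?thesis unfolding sym_count_def UNIV_bool by (cases "\<epsilon> x"; cases "\<epsilon> y") simp_all
qed

subsection \<open>Test words\<close>

text \<open>The extra \<open>a\<close> separates consecutive copies, so no two letters
  \<open>b\<close> are adjacent in a power of this word.\<close>

definition test_word :: "nat \<Rightarrow> 'v \<Rightarrow> 'v \<Rightarrow> ('v \<times> bool) list" where
  "test_word j a b = pattern j a b True True @ [(a, True)]"

text \<open>The accumulator holds the number of letters since the last \<open>b\<close>; an
  unfinished last run is dropped.\<close>

primrec runs :: "'v \<Rightarrow> nat \<Rightarrow> ('v \<times> bool) list \<Rightarrow> nat list" where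
  "runs b c [] = []"
| "runs b c (z # w) = (if fst z = b then c # runs b 0 w else runs b (Suc c) w)"

lemma runs_replicate: "a \<noteq> b \<Longrightarrow> runs b c (replicate n (a, e) @ w) = runs b (c + n) w"
  by (induction n arbitrary: c) auto

lemma runs_append: "\<exists>c'. \<forall>w. runs b c (p @ w) = runs b c p @ runs b c' w"
proof (induction p arbitrary: c)
  case (Cons z p)
  show ?case using Cons.IH[of 0] Cons.IH[of "Suc c"] by auto
qed auto

text \<open>The initial counter 1 stands for the final \<open>a\<close> of a preceding copy and
  makes the list exactly periodic.\<close>

lemma runs_test_word:
  assumes "a \<noteq> b"
  shows "runs b 1 (concat (replicate n (test_word j a b))) = concat (replicate n [1, 2, j + 3])"
proof (induction n)
  case (Suc n)
  then show ?case using assms runs_replicate[OF assms, of _ "j + 3"]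
    by (simp add: test_word_def pattern_def numeral_3_eq_3)
qed simp

lemma runs_infix:
  assumes "a \<noteq> b" "w = p @ [(b, True)] @ replicate m (a, True) @ [(b, True)] @ replicate n (a, True) @ [(b, True)] @ q"
  shows "\<exists>ps qs. runs b c w = ps @ [m, n] @ qs"
proof -
  obtain c' where "runs b c w = runs b c p @
      runs b c' ([(b, True)] @ replicate m (a, True) @ [(b, True)] @ replicate n (a, True) @ [(b, True)] @ q)"
    using runs_append assms(2) by metis
  also have "\<dots> = (runs b c p @ [c']) @ [m, n] @ runs b 0 q"
    using assms(1) by (simp add: runs_replicate)
  finally show ?thesis by blast
qed

text \<open>The neighbouring pairs are (1, 2), (2, j + 3) and (j + 3, 1), and \<open>j + 3\<close>
  is never 2.\<close>

lemma periodic_infix: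
  fixes j :: nat
  assumes "concat (replicate k [1, 2, j + 3]) = ps @ [m, n] @ qs"
  shows "m \<noteq> 0 \<and> (m = 2 \<longrightarrow> n = j + 3) \<and> (n = 2 \<longrightarrow> m = 1)"
  using assms
proof (induction k arbitrary: ps)
  case (Suc k)
  then have eq: "1 # 2 # (j + 3) # concat (replicate k [1, 2, j + 3]) = ps @ m # n # qs" by simp
  show ?case
  proof (cases ps)
    case Nil
    then show ?thesis using eq by simp
  next
    case (Cons p1 ps1)
    show ?thesis
    proof (cases ps1)
      case Nil
      then show ?thesis using eq Cons by simp
    next
      case (Cons p2 ps2)
      show ?thesis
      proof (cases ps2)
        case Nil
        then show ?thesis using eq \<open>ps = p1 # ps1\<close> Cons by (cases k) auto
      next
        case (Cons p3 ps3)
        then have "concat (replicate k [1, 2, j + 3]) = ps3 @ [m, n] @ qs"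
          using eq \<open>ps = p1 # ps1\<close> \<open>ps1 = p2 # ps2\<close> by auto
        then show ?thesis by (rule Suc.IH)
      qed
    qed
  qed
qed simp

lemma winv_pattern:
  "winv (pattern i x y e d) =
     [(y, \<not> d)] @ replicate (i + 3) (x, \<not> e) @ [(y, \<not> d)] @ replicate 2 (x, \<not> e) @ [(y, \<not> d)]"
  by (simp add: pattern_def winv_def linv_def numeral_2_eq_2)

lemma positive_reduced: "(\<And>z. z \<in> set v \<Longrightarrow> snd z) \<Longrightarrow> reduced v"
proof (induction v)
  case (Cons z v)
  then have "v = [] \<or> snd (hd v)" "snd z" by (simp_all del: split_paired_All) (metis hd_in_set)
  then have "v = [] \<or> hd v \<noteq> linv z" unfolding linv_def by (metis snd_conv)
  then show ?case using Cons by (simp add: reduced_Cons)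
qed simp

text \<open>A positive word contains only positive factors: the pattern with both signs positive and
  the inverse of the one with both negative.\<close>

lemma sym_count_positive:
  assumes "\<And>z. z \<in> set r \<Longrightarrow> snd z"
  shows "sym_count i x y r
    = real (cnt (pattern i x y True True) r) - real (cnt (winv (pattern i x y False False)) r)"
proof -
  have c0: "cnt u r = 0" if "\<exists>z\<in>set u. \<not> snd z" for u
    using that assms by (intro cnt_eq_0_set) auto
  have "cnt (pattern i x y e d) r = 0" if "\<not> (e \<and> d)" for e d
    using that by (intro c0) (auto simp: pattern_def)
  moreover have "cnt (winv (pattern i x y e d)) r = 0" if "e \<or> d" for e d
    using that by (intro c0) (auto simp: winv_pattern)
  ultimately show ?thesis
    using nf_reduced[OF positive_reduced[OF assms]] by (simp add: sym_count_def UNIV_bool brooks_def)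
qed

context
  fixes a b :: 'v and j n :: nat and w :: "('v \<times> bool) list"
  assumes ab: "a \<noteq> b" and w: "w = concat (replicate n (test_word j a b))"
begin

lemma set_test: "set w \<subseteq> {(a, True), (b, True)}"
  by (auto simp: w test_word_def pattern_def)

lemma test_runs:
  assumes "w = p @ [(b, True)] @ replicate m (a, True) @ [(b, True)] @ replicate k (a, True) @ [(b, True)] @ q"
  shows "m \<noteq> 0 \<and> (m = 2 \<longrightarrow> k = j + 3) \<and> (k = 2 \<longrightarrow> m = 1)"
  using runs_infix[OF ab assms, of 1] runs_test_word[OF ab, of n j] periodic_infix[of n j] w by metis

lemma test_factor:
  assumes "del {x, y} w = p @ u @ q" "(x, True) \<in> set u" "(y, True) \<in> set u" "x \<noteq> y"
  shows "w = p @ u @ q" "(x, y) = (a, b) \<or> (x, y) = (b, a)"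
proof -
  have "(x, True) \<in> set (del {x, y} w)" "(y, True) \<in> set (del {x, y} w)" unfolding assms using assms by auto
  then have "(x, True) \<in> set w" "(y, True) \<in> set w" by (auto simp: set_del)
  then show xy: "(x, y) = (a, b) \<or> (x, y) = (b, a)" using set_test assms(4) by auto
  have "fst ` set w \<subseteq> {x, y}" using xy set_test by auto
  from del_id[OF this] show "w = p @ u @ q" using assms(1) by simp
qed

lemma cnt_test_zero:
  assumes "x \<noteq> y" "(x, y) \<noteq> (a, b) \<or> i \<noteq> j"
  shows "cnt (pattern i x y True True) (del {x, y} w) = 0"
proof (rule cnt_eq_0, rule notI)
  fix p q assume "del {x, y} w = p @ pattern i x y True True @ q"
  from test_factor[OF this] assms(1)
  have w': "w = p @ pattern i x y True True @ q" and xy: "(x, y) = (a, b) \<or> (x, y) = (b, a)"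
    by (simp_all add: pattern_def)
  show False
  proof (cases "(x, y) = (a, b)")
    case True
    then have "w = p @ [(b, True)] @ replicate 2 (a, True) @ [(b, True)] @ replicate (i + 3) (a, True) @ [(b, True)] @ q"
      using w' by (simp add: pattern_def numeral_2_eq_2)
    from test_runs[OF this] show False using True assms by simp
  next
    case False
    then have "x = b" "y = a" using xy by auto
    \<comment> \<open>With the roles exchanged the pattern contains \<open>b b\<close>, a run of
      length 0.\<close>
    then have "w = (p @ [(a, True)]) @ [(b, True)] @ replicate 0 (a, True) @ [(b, True)] @ replicate 1 (a, True)
        @ [(b, True)] @ (replicate (i + 2) (b, True) @ [(a, True)] @ q)"
      using w' xy by (simp add: pattern_def numeral_2_eq_2 numeral_3_eq_3)
    from test_runs[OF this] show False by simp
  qed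
qed

text \<open>The inverse shows run \<open>i + 3\<close> before run 2, while in the test word a run 2
  follows only a run 1.\<close>

lemma cnt_test_reverse_zero:
  assumes "x \<noteq> y"
  shows "cnt (winv (pattern i x y False False)) (del {x, y} w) = 0"
proof (rule cnt_eq_0, rule notI)
  fix p q assume "del {x, y} w = p @ winv (pattern i x y False False) @ q"
  from test_factor[OF this] assms
  have w': "w = p @ winv (pattern i x y False False) @ q" and xy: "(x, y) = (a, b) \<or> (x, y) = (b, a)"
    by (simp_all add: winv_pattern)
  show False
  proof (cases "(x, y) = (a, b)")
    case True
    then have "w = p @ [(b, True)] @ replicate (i + 3) (a, True) @ [(b, True)] @ replicate 2 (a, True) @ [(b, True)] @ q"
      using w' by (simp add: winv_pattern)
    from test_runs[OF this] show False by simp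
  next
    case False
    then have "x = b" "y = a" using xy by auto
    then have "w = (p @ [(a, True)]) @ [(b, True)] @ replicate 0 (a, True) @ [(b, True)] @ replicate 0 (a, True)
        @ [(b, True)] @ (replicate i (b, True) @ [(a, True), (b, True), (b, True), (a, True)] @ q)"
      using w' xy by (simp add: winv_pattern numeral_2_eq_2 numeral_3_eq_3)
    from test_runs[OF this] show False by simp
  qed
qed

lemma cnt_test_ge: "n \<le> cnt (pattern j a b True True) w"
  unfolding w
proof (induction n)
  case (Suc n)
  let ?u = "pattern j a b True True" and ?t = "test_word j a b"
  have "[] \<in> occ ?u ?t" by (simp add: occ_def test_word_def)
  then have "1 \<le> cnt ?u ?t" unfolding cnt_def by (simp add: card_gt_0_iff Suc_le_eq) blast
  moreover have "?u \<noteq> []" by (simp add: pattern_def)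
  from cnt_append_ge[OF this, of ?t "concat (replicate n ?t)"]
  have "cnt ?u ?t + cnt ?u (concat (replicate n ?t)) \<le> cnt ?u (concat (replicate (Suc n) ?t))" by simp
  ultimately show ?case using Suc by simp
qed simp

lemma sym_count_test_zero:
  assumes "x \<noteq> y" "(x, y) \<noteq> (a, b) \<or> i \<noteq> j"
  shows "sym_count i x y (del {x, y} w) = 0"
  using set_test cnt_test_zero[OF assms] cnt_test_reverse_zero[OF assms(1)]
  by (subst sym_count_positive) (auto simp: set_del)

lemma sym_count_test_ge: "real n \<le> sym_count j a b (del {a, b} w)"
proof -
  have "del {a, b} w = w" using set_test by (intro del_id) auto
  then show ?thesis using set_test cnt_test_ge cnt_test_reverse_zero[OF ab]
    by (subst sym_count_positive) (auto simp: set_del)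
qed

end

section \<open>Homogenization\<close>

text \<open>The intervals of radius \<open>D / n\<close> around \<open>a n / n\<close> meet
  pairwise, so the supremum \<open>L\<close> of their left ends lies in all of them.\<close>

lemma almost_additive_slope:
  fixes a :: "nat \<Rightarrow> real"
  assumes "\<And>m n. \<bar>a m + a n - a (m + n)\<bar> \<le> D"
  shows "\<exists>L. \<forall>n. \<bar>a n - real n * L\<bar> \<le> D"
proof -
  have mult: "\<bar>a (Suc k * n) - real (Suc k) * a n\<bar> \<le> real k * D" for k n
  proof (induction k)
    case (Suc k)
    then show ?case using assms[of n "Suc k * n"] by (simp add: algebra_simps)
  qed simp
  let ?l = "\<lambda>n. (a n - D) / real n" and ?u = "\<lambda>n. (a n + D) / real n"
  have le: "?l m \<le> ?u n" if mn: "m \<ge> 1" "n \<ge> 1" for m n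
  proof -
    obtain p q where pq: "m = Suc p" "n = Suc q" using mn by (metis Suc_le_D One_nat_def)
    have "real n * a m - real m * a n \<le> real q * D + real p * D"
      using mult[of q m] mult[of p n] pq by (simp add: mult.commute)
    moreover have "0 \<le> D" using assms[of 0 0] by linarith
    ultimately have "real n * (a m - D) \<le> real m * (a n + D)" by (simp add: pq algebra_simps)
    then show ?thesis using mn by (simp add: field_simps)
  qed
  define L where "L = (SUP n\<in>{1..}. ?l n)"
  have "?l n \<le> L" if "n \<ge> 1" for n
    unfolding L_def using that le[of _ 1] by (intro cSUP_upper) (auto intro!: bdd_aboveI2)
  moreover have "L \<le> ?u n" if "n \<ge> 1" for n
    unfolding L_def using that le by (intro cSUP_least) auto
  ultimately have "\<bar>a n - real n * L\<bar> \<le> D" if "n \<ge> 1" for n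
    using that by (simp add: abs_le_iff field_simps)
  moreover have "\<bar>a 0\<bar> \<le> D" using assms[of 0 0] by simp
  ultimately show ?thesis by (metis less_one mult_zero_left not_le of_nat_0 diff_zero)
qed

lemma bounded_multiples_zero:
  fixes c :: real
  assumes "\<And>n::nat. real n * \<bar>c\<bar> \<le> C" shows "c = 0"
proof (rule ccontr)
  assume "c \<noteq> 0"
  then obtain n :: nat where "C < real n * \<bar>c\<bar>" using ex_less_of_nat_mult[of "\<bar>c\<bar>" C] by auto
  then show False using assms[of n] by simp
qed

lemma slope_unique:
  fixes a :: "nat \<Rightarrow> real"
  assumes "\<And>n. \<bar>a n - real n * L\<bar> \<le> C" "\<And>n. \<bar>a n - real n * L'\<bar> \<le> C'"
  shows "L = L'"
proof -
  have "real n * \<bar>L - L'\<bar> \<le> C + C'" for n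
  proof -
    have "real n * \<bar>L - L'\<bar> = \<bar>real n * L - real n * L'\<bar>" by (simp add: abs_mult flip: right_diff_distrib)
    then show ?thesis using assms(1)[of n] assms(2)[of n] by linarith
  qed
  then show ?thesis using bounded_multiples_zero by force
qed

context group
begin

lemma homogenization:
  assumes qm: "\<And>g h. g \<in> carrier G \<Longrightarrow> h \<in> carrier G \<Longrightarrow> \<bar>f g + f h - f (g \<otimes> h)\<bar> \<le> D"
  shows "\<exists>\<psi>. homogeneous G \<psi> \<and> (\<forall>g\<in>carrier G. \<bar>\<psi> g - f g\<bar> \<le> D)"
proof -
  have "\<forall>g\<in>carrier G. \<exists>L. \<forall>n::nat. \<bar>f (g [^] n) - real n * L\<bar> \<le> D"
  proof
    fix g assume "g \<in> carrier G"
    then show "\<exists>L. \<forall>n::nat. \<bar>f (g [^] n) - real n * L\<bar> \<le> D"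
      by (intro almost_additive_slope) (use qm in \<open>simp flip: nat_pow_mult\<close>)
  qed
  then obtain \<psi> where \<psi>: "\<And>g n. g \<in> carrier G \<Longrightarrow> \<bar>f (g [^] (n::nat)) - real n * \<psi> g\<bar> \<le> D"
    by metis
  have pow: "\<psi> (g [^] m) = real m * \<psi> g" if g: "g \<in> carrier G" for g and m :: nat
  proof (rule slope_unique)
    show "\<bar>f ((g [^] m) [^] n) - real n * \<psi> (g [^] m)\<bar> \<le> D" for n :: nat using \<psi> g by simp
    show "\<bar>f ((g [^] m) [^] n) - real n * (real m * \<psi> g)\<bar> \<le> D" for n :: nat
      using \<psi>[OF g, of "m * n"] g by (simp add: nat_pow_pow mult_ac)
  qed
  have inv: "\<psi> (inv g) = - \<psi> g" if g: "g \<in> carrier G" for g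
  proof (rule slope_unique)
    show "\<bar>f (inv g [^] n) - real n * \<psi> (inv g)\<bar> \<le> D" for n :: nat using \<psi> g by simp
    \<comment> \<open>One \<open>D\<close> comes from splitting the identity as
      \<open>g^-n g^n\<close>, the other from comparing \<open>f\<close> at \<open>g^n\<close> with
      its slope.\<close>
    show "\<bar>f (inv g [^] n) - real n * (- \<psi> g)\<bar> \<le> 2 * D + \<bar>f \<one>\<bar>" for n :: nat
      using qm[of "inv (g [^] n)" "g [^] n"] \<psi>[OF g, of n] g by (simp add: nat_pow_inv)
  qed
  have "homogeneous G \<psi>"
    unfolding homogeneous_def
  proof (intro ballI allI)
    fix g and n :: int assume g: "g \<in> carrier G"
    show "\<psi> (g [^] n) = of_int n * \<psi> g"
      by (cases n rule: int_cases2) (use g pow inv in \<open>simp_all add: int_pow_neg int_pow_int\<close>)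
  qed
  moreover have "\<bar>\<psi> g - f g\<bar> \<le> D" if "g \<in> carrier G" for g
    using \<psi>[OF that, of 1] that by (simp add: abs_minus_commute)
  ultimately show ?thesis by blast
qed

lemma homogeneous_nat_pow:
  "homogeneous G \<psi> \<Longrightarrow> g \<in> carrier G \<Longrightarrow> \<psi> (g [^] (n::nat)) = real n * \<psi> g"
  unfolding homogeneous_def by (metis int_pow_int of_int_of_nat_eq)

lemma homogeneous_aut_invariant:
  assumes \<psi>: "homogeneous G \<psi>" and \<phi>: "\<phi> \<in> iso G G"
    and C: "\<And>g. g \<in> carrier G \<Longrightarrow> \<bar>\<psi> (\<phi> g) - \<psi> g\<bar> \<le> C" and g: "g \<in> carrier G"
  shows "\<psi> (\<phi> g) = \<psi> g"
proof -
  have hom: "\<phi> \<in> hom G G" using \<phi> by (simp add: iso_def)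
  have \<phi>g: "\<phi> g \<in> carrier G" using hom g by (auto simp: hom_def)
  have "real n * \<bar>\<psi> (\<phi> g) - \<psi> g\<bar> \<le> C" for n
  proof -
    have "\<phi> (g [^] n) = \<phi> g [^] n" using hom_nat_pow[OF hom g] is_group by blast
    then have "\<psi> (\<phi> (g [^] n)) - \<psi> (g [^] n) = real n * (\<psi> (\<phi> g) - \<psi> g)"
      using homogeneous_nat_pow[OF \<psi>] g \<phi>g by (simp add: right_diff_distrib)
    then show ?thesis using C[of "g [^] n"] g by (simp add: abs_mult)
  qed
  then show ?thesis using bounded_multiples_zero by force
qed

end

lemma quasimorphism_bounded_dist:
  assumes "group G" "\<And>g h. g \<in> carrier G \<Longrightarrow> h \<in> carrier G \<Longrightarrow> \<bar>f g + f h - f (g \<otimes>\<^bsub>G\<^esub> h)\<bar> \<le> D"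
    and "\<And>g. g \<in> carrier G \<Longrightarrow> \<bar>\<psi> g - f g\<bar> \<le> C"
  shows "quasimorphism G \<psi>"
  unfolding quasimorphism_def
proof (intro exI ballI)
  interpret group G by fact
  fix g h assume "g \<in> carrier G" "h \<in> carrier G"
  then show "\<bar>\<psi> g + \<psi> h - \<psi> (g \<otimes>\<^bsub>G\<^esub> h)\<bar> \<le> D + 3 * C"
    using assms(2)[of g h] assms(3)[of g] assms(3)[of h] assms(3)[of "g \<otimes>\<^bsub>G\<^esub> h"] by simp
qed

section \<open>Quasimorphisms on the right angled Artin group\<close>

context raag
begin

abbreviation "A \<equiv> RAAG V E"
abbreviation "cls \<equiv> raag_class V E"

lemma carrier_A: "carrier A = cls ` words"
  and one_A: "\<one>\<^bsub>A\<^esub> = cls []"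
  by (simp_all add: RAAG_def)

lemma mult_A: "cls a \<otimes>\<^bsub>A\<^esub> cls b = cls (a @ b)"
proof -
  have "(\<exists>a'\<in>cls a. \<exists>b'\<in>cls b. a' @ b' \<doteq> w) \<longleftrightarrow> a @ b \<doteq> w" for w
    unfolding raag_class_def using eqv_append eqv_trans eqv_refl by blast
  then show ?thesis by (simp add: RAAG_def raag_class_def[of V E "a @ b"])
qed

lemma group_A: "group A"
proof (rule groupI)
  fix g assume "g \<in> carrier A"
  then obtain w where w: "w \<in> words" "g = cls w" by (auto simp: carrier_A)
  have "cls (winv w) \<otimes>\<^bsub>A\<^esub> g = \<one>\<^bsub>A\<^esub>" using left_inv w by (simp add: mult_A one_A class_eq_iff)
  then show "\<exists>h\<in>carrier A. h \<otimes>\<^bsub>A\<^esub> g = \<one>\<^bsub>A\<^esub>" using w by (auto simp: carrier_A)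
qed (auto simp: carrier_A one_A mult_A)

sublocale A: group A by (rule group_A)

lemma pow_A: "cls w [^]\<^bsub>A\<^esub> n = cls (concat (replicate n w))" if "w \<in> words"
proof (induction n)
  case (Suc n)
  have "concat (replicate (Suc n) w) = concat (replicate n w) @ w"
    by (simp flip: replicate_append_same)
  then show ?case using Suc by (simp add: mult_A)
qed (simp add: one_A)

definition rep :: "('v \<times> bool) list set \<Rightarrow> ('v \<times> bool) list" where
  "rep g = (SOME w. w \<in> words \<and> cls w = g)"

lemma rep: "g \<in> carrier A \<Longrightarrow> rep g \<in> words \<and> cls (rep g) = g"
  unfolding rep_def carrier_A by (rule someI_ex) auto

lemma rep_cls: "w \<in> words \<Longrightarrow> rep (cls w) \<doteq> w"
  using rep[of "cls w"] by (auto simp: carrier_A class_eq_iff)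

text \<open>Ordered pairs, because \<open>pattern\<close> distinguishes \<open>x\<close> from
  \<open>y\<close> and a graph automorphism may exchange the two.\<close>

definition nonadjacent :: "('v \<times> 'v) set" where
  "nonadjacent = {(x, y). x \<in> V \<and> y \<in> V \<and> x \<noteq> y \<and> {x, y} \<notin> E}"

definition total_count :: "nat \<Rightarrow> ('v \<times> bool) list \<Rightarrow> real" where
  "total_count i w = (\<Sum>(x, y)\<in>nonadjacent. sym_count i x y (del {x, y} w))"

lemma finite_nonadjacent: "finite nonadjacent"
  by (rule finite_subset[of _ "V \<times> V"]) (auto simp: nonadjacent_def finite_V)

text \<open>No swap involves both \<open>x\<close> and \<open>y\<close>, so deletion lands in the
  free group on them.\<close>

lemma eqv_nf_del:
  assumes "a \<doteq> b" "{x, y} \<notin> E" shows "nf (del {x, y} a) = nf (del {x, y} b)"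
proof (rule eqv_invariant[OF assms(1), where f = "\<lambda>w. nf (del {x, y} w)"], goal_cases)
  case (1 xs v b ys)
  then show ?case using nf_cancel_letter[of "del {x, y} xs" "(v, b)"] by (simp add: linv_def)
next
  case (2 xs u b w c ys)
  then have "\<not> (u \<in> {x, y} \<and> w \<in> {x, y})" using edgeD[OF 2] assms(2) by (auto simp: insert_commute)
  then show ?case by auto
qed

lemma total_count_cong: "a \<doteq> b \<Longrightarrow> total_count i a = total_count i b"
  unfolding total_count_def
  by (intro sum.cong refl) (auto simp: nonadjacent_def intro!: sym_count_cong eqv_nf_del)

lemma total_count_quasi:
  "\<bar>total_count i a + total_count i b - total_count i (a @ b)\<bar> \<le> card nonadjacent * (12 * real (i + 8))"
proof -
  have "total_count i a + total_count i b - total_count i (a @ b) =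
     (\<Sum>(x, y)\<in>nonadjacent. sym_count i x y (del {x, y} a) + sym_count i x y (del {x, y} b)
        - sym_count i x y (del {x, y} a @ del {x, y} b))"
    by (simp add: total_count_def case_prod_unfold sum.distrib sum_subtractf)
  also have "\<bar>\<dots>\<bar> \<le> card nonadjacent * (12 * real (i + 8))"
    using sym_count_quasi by (intro order.trans[OF sum_abs] sum_bounded_above) auto
  finally show ?thesis .
qed

end

section \<open>Effect of an automorphism on the total count\<close>

context raag_aut
begin

lemma total_count_aut:
  "\<exists>D. \<forall>w\<in>words. \<bar>total_count i (\<Phi> w) - total_count i w\<bar> \<le> D"
proof -
  obtain \<pi> k \<epsilon> where \<pi>: "bij_betw \<pi> V V"
    and edge: "\<And>u v. {u, v} \<in> E \<Longrightarrow> {\<pi> u, \<pi> v} \<in> E"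
    and \<Phi>: "\<And>v. v \<in> V \<Longrightarrow> \<Phi> (gen v) \<doteq> k v @ [(\<pi> v, \<epsilon> v)] @ winv (k v)"
    using aut_permutes_generators_up_to_conj by blast
  have inj: "inj_on \<pi> V" and \<pi>V: "\<And>v. v \<in> V \<Longrightarrow> \<pi> v \<in> V"
    using \<pi> by (auto simp: bij_betw_def)
  define s where "s z = (\<pi> (fst z), snd z = \<epsilon> (fst z))" for z
  have \<Phi>1: "\<Phi> [z] \<doteq> k (fst z) @ [s z] @ winv (k (fst z))" if "fst z \<in> V" for z
  proof (cases "snd z")
    case True
    then show ?thesis using \<Phi>[OF that] by (cases z) (simp add: s_def)
  next
    case False
    then have z: "[z] = winv (gen (fst z))" by (cases z) (simp add: linv_def)
    have "\<Phi> [z] \<doteq> winv (\<Phi> (gen (fst z)))" unfolding z using that by (intro \<Phi>_winv) simp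
    also have "\<dots> \<doteq> winv (k (fst z) @ [(\<pi> (fst z), \<epsilon> (fst z))] @ winv (k (fst z)))"
      using \<Phi> \<Phi>_words that by (intro eqv_winv) auto
    finally show ?thesis using False by (simp add: s_def linv_def winv_Cons)
  qed
  have pair: "\<bar>sym_count i (\<pi> x) (\<pi> y) (del {\<pi> x, \<pi> y} (\<Phi> w)) - sym_count i x y (del {x, y} w)\<bar> \<le> 24 * real (i + 8)"
    if w: "w \<in> words" and xy: "x \<in> V" "y \<in> V" "x \<noteq> y" and ne: "{\<pi> x, \<pi> y} \<notin> E" for x y w
  proof -
    let ?S = "{\<pi> x, \<pi> y}"
    have \<pi>xy: "\<pi> x \<noteq> \<pi> y" using inj xy by (auto dest: inj_onD)
    have mem: "\<pi> v \<in> ?S \<longleftrightarrow> v \<in> {x, y}" if "v \<in> V" for v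
      using inj xy that by (auto dest: inj_onD)
    define a b where "a = del ?S (k x)" and "b = del ?S (k y)"
    define \<sigma> where "\<sigma> z = (if fst z = \<pi> x then a @ [z] @ winv a else b @ [z] @ winv b)" for z
    have letter: "nf (del ?S (\<Phi> [z])) = nf (concat (map \<sigma> (map s (del {x, y} [z]))))" if z: "fst z \<in> V" for z
    proof -
      have "nf (del ?S (\<Phi> [z])) = nf (del ?S (k (fst z)) @ del ?S [s z] @ winv (del ?S (k (fst z))))"
        using eqv_nf_del[OF \<Phi>1[OF z] ne] by (simp add: del_winv)
      also have "\<dots> = nf (concat (map \<sigma> (map s (del {x, y} [z]))))"
      proof (cases "fst z \<in> {x, y}")
        case True
        then show ?thesis using mem[OF z] \<pi>xy by (auto simp: \<sigma>_def s_def a_def b_def)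
      next
        case False
        then show ?thesis using mem[OF z] by (simp add: s_def nf_right_inv)
      qed
      finally show ?thesis .
    qed
    have word: "nf (del ?S (\<Phi> w)) = nf (concat (map \<sigma> (map s (del {x, y} w))))" if "w \<in> words" for w
      using that
    proof (induction w)
      case Nil
      then show ?case using eqv_nf_del[OF \<Phi>_Nil ne] by simp
    next
      case (Cons z w)
      have "nf (del ?S (\<Phi> ([z] @ w))) = nf (del ?S (\<Phi> [z]) @ del ?S (\<Phi> w))"
        using eqv_nf_del[OF \<Phi>_append ne, of "[z]" w] Cons.prems by simp
      also have "\<dots> = nf (concat (map \<sigma> (map s (del {x, y} [z]))) @ concat (map \<sigma> (map s (del {x, y} w))))"
        using Cons letter by (intro nf_append_cong) simp_all
      also have "\<dots> = nf (concat (map \<sigma> (map s (del {x, y} (z # w)))))" by simp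
      finally show ?case by simp
    qed
    have s_set: "fst ` set (map s (del {x, y} w)) \<subseteq> ?S" for w by (auto simp: s_def set_del)
    \<comment> \<open>Every word in the two image generators is reached, by applying
      \<open>word\<close> to its \<Psi>-image. Hence the conjugators \<open>a\<close> and
      \<open>b\<close> can be replaced by one.\<close>
    have "\<exists>K. fst ` set K \<subseteq> ?S \<and> (\<forall>z. fst z \<in> ?S \<longrightarrow> nf (\<sigma> z) = nf (K @ [z] @ winv K))"
    proof (rule generating_conjugates[OF \<pi>xy _ _ \<sigma>_def])
      show "fst ` set a \<subseteq> ?S" "fst ` set b \<subseteq> ?S" by (auto simp: a_def b_def set_del)
      fix t :: "('v \<times> bool) list" assume t: "fst ` set t \<subseteq> ?S"
      then have tw: "t \<in> words" using xy \<pi>V by (auto simp: words_iff)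
      have "nf (concat (map \<sigma> (map s (del {x, y} (\<Psi> t))))) = nf (del ?S t)"
        using word[OF \<Psi>_words[OF tw]] eqv_nf_del[OF \<Phi>_\<Psi>[OF tw] ne] by simp
      then show "\<exists>w. fst ` set w \<subseteq> ?S \<and> nf (concat (map \<sigma> w)) = nf t"
        using s_set del_id[OF t] by metis
    qed
    then obtain K where K: "\<And>z. fst z \<in> ?S \<Longrightarrow> nf (\<sigma> z) = nf (K @ [z] @ winv K)" by blast
    have "nf (\<sigma> z) = nf (K @ [z] @ winv K)" if "z \<in> set (map s (del {x, y} w))" for z
      using that s_set[of w] by (intro K) blast
    from nf_concat_conj[of "map s (del {x, y} w)" \<sigma> K "\<lambda>z. [z]", OF this]
    have "nf (del ?S (\<Phi> w)) = nf (K @ map s (del {x, y} w) @ winv K)"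
      using word[OF w] by (simp del: map_map)
    from sym_count_conj[OF this, of i "\<pi> x" "\<pi> y"]
    moreover have "sym_count i (\<pi> x) (\<pi> y) (map s (del {x, y} w)) = sym_count i x y (del {x, y} w)"
      using xy \<pi>xy by (intro sym_count_map[where \<epsilon> = \<epsilon>]) (auto simp: s_def set_del)
    ultimately show ?thesis by simp
  qed
  let ?p = "map_prod \<pi> \<pi>"
  \<comment> \<open>Since \<pi> preserves edges, preimages of nonadjacent pairs are nonadjacent;
    comparing cardinalities turns the inclusion into equality.\<close>
  have "nonadjacent \<subseteq> ?p ` nonadjacent"
  proof
    fix z assume "z \<in> nonadjacent"
    then obtain x y where z: "z = (x, y)" "x \<in> V" "y \<in> V" "x \<noteq> y" "{x, y} \<notin> E"
      by (auto simp: nonadjacent_def)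
    then obtain x' y' where "x' \<in> V" "y' \<in> V" "x = \<pi> x'" "y = \<pi> y'"
      using \<pi> by (metis bij_betw_imp_surj_on imageE)
    then have "(x', y') \<in> nonadjacent" "z = ?p (x', y')" using z edge by (auto simp: nonadjacent_def)
    then show "z \<in> ?p ` nonadjacent" by blast
  qed
  then have image: "?p ` nonadjacent = nonadjacent"
    using card_image_le[OF finite_nonadjacent, of ?p] finite_nonadjacent
    by (metis card_seteq finite_imageI)
  have inj_p: "inj_on ?p nonadjacent"
    using inj by (auto simp: nonadjacent_def inj_on_def)
  have "\<bar>total_count i (\<Phi> w) - total_count i w\<bar> \<le> card nonadjacent * (24 * real (i + 8))"
    if w: "w \<in> words" for w
  proof -
    have "total_count i (\<Phi> w) = (\<Sum>(x, y)\<in>?p ` nonadjacent. sym_count i x y (del {x, y} (\<Phi> w)))"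
      by (simp add: image total_count_def)
    also have "\<dots> = (\<Sum>(x, y)\<in>nonadjacent. sym_count i (\<pi> x) (\<pi> y) (del {\<pi> x, \<pi> y} (\<Phi> w)))"
      by (simp add: sum.reindex[OF inj_p] case_prod_unfold)
    finally have "total_count i (\<Phi> w) - total_count i w = (\<Sum>(x, y)\<in>nonadjacent.
        sym_count i (\<pi> x) (\<pi> y) (del {\<pi> x, \<pi> y} (\<Phi> w)) - sym_count i x y (del {x, y} w))"
      by (simp add: total_count_def case_prod_unfold sum_subtractf)
    also have "\<bar>\<dots>\<bar> \<le> card nonadjacent * (24 * real (i + 8))"
    proof (intro order.trans[OF sum_abs] sum_bounded_above)
      fix z assume z: "z \<in> nonadjacent"
      then have "?p z \<in> nonadjacent" using image by blast
      then show "\<bar>case z of (x, y) \<Rightarrow> sym_count i (\<pi> x) (\<pi> y) (del {\<pi> x, \<pi> y} (\<Phi> w))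
          - sym_count i x y (del {x, y} w)\<bar> \<le> 24 * real (i + 8)"
        using z pair[OF w] by (auto simp: nonadjacent_def)
    qed
    finally show ?thesis .
  qed
  then show ?thesis by blast
qed

end

section \<open>Invariant quasimorphisms and their values on test words\<close>

context raag
begin

lemma iso_raag_aut:
  assumes \<phi>: "\<phi> \<in> iso A A" and nodom: "\<not> (\<exists>x\<in>V. \<exists>y\<in>V. x \<noteq> y \<and> lk E x \<subseteq> st E y)"
  shows "raag_aut V E (\<lambda>w. rep (\<phi> (cls w))) (\<lambda>w. rep (inv_into (carrier A) \<phi> (cls w)))"
proof -
  let ?\<theta> = "inv_into (carrier A) \<phi>"
  have \<theta>: "?\<theta> \<in> iso A A" using A.iso_set_sym[OF \<phi>] .
  have bij: "bij_betw \<phi> (carrier A) (carrier A)" using \<phi> by (simp add: iso_def)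
  have closed: "\<chi> (cls w) \<in> carrier A" if "\<chi> \<in> iso A A" "w \<in> words" for \<chi> w
    using that by (auto simp: iso_def hom_def carrier_A)
  have words: "rep (\<chi> (cls w)) \<in> words" and cls_rep: "cls (rep (\<chi> (cls w))) = \<chi> (cls w)"
    if "\<chi> \<in> iso A A" "w \<in> words" for \<chi> w
    using rep[OF closed[OF that]] by auto
  have append: "rep (\<chi> (cls (a @ b))) \<doteq> rep (\<chi> (cls a)) @ rep (\<chi> (cls b))"
    if \<chi>: "\<chi> \<in> iso A A" and ab: "a \<in> words" "b \<in> words" for \<chi> a b
  proof -
    have "\<chi> (cls a \<otimes>\<^bsub>A\<^esub> cls b) = \<chi> (cls a) \<otimes>\<^bsub>A\<^esub> \<chi> (cls b)"
      using \<chi> ab by (auto simp: iso_def hom_def carrier_A)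
    then have "\<chi> (cls (a @ b)) = cls (rep (\<chi> (cls a)) @ rep (\<chi> (cls b)))"
      using cls_rep[OF \<chi>] ab by (metis mult_A)
    then show ?thesis using cls_rep[OF \<chi>, of "a @ b"] ab by (simp flip: class_eq_iff)
  qed
  have cong: "rep (\<chi> (cls a)) \<doteq> rep (\<chi> (cls b))" if "a \<doteq> b" for \<chi> a b
    using that eqv_refl[of "rep (\<chi> (cls b))"] by (simp only: class_eq_iff[symmetric])
  have in_carrier: "cls w \<in> carrier A" if "w \<in> words" for w using that by (simp add: carrier_A)
  show ?thesis
  proof unfold_locales
    fix w assume w: "w \<in> words"
    have "cls (rep (?\<theta> (cls (rep (\<phi> (cls w)))))) = cls w"
      using cls_rep[OF \<theta> words[OF \<phi> w]] cls_rep[OF \<phi> w] bij_betw_inv_into_left[OF bij in_carrier[OF w]] by simp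
    then show "rep (?\<theta> (cls (rep (\<phi> (cls w))))) \<doteq> w" by (simp add: class_eq_iff)
    have "cls (rep (\<phi> (cls (rep (?\<theta> (cls w)))))) = cls w"
      using cls_rep[OF \<phi> words[OF \<theta> w]] cls_rep[OF \<theta> w] bij_betw_inv_into_right[OF bij in_carrier[OF w]] by simp
    then show "rep (\<phi> (cls (rep (?\<theta> (cls w))))) \<doteq> w" by (simp add: class_eq_iff)
  qed (use words[OF \<phi>] words[OF \<theta>] append[OF \<phi>] append[OF \<theta>] cong nodom in auto)
qed

text \<open>The homogenization stays within a constant of the total count, so it too moves boundedly
  under an automorphism; homogeneity then makes the change vanish.\<close>

lemma homogeneous_count:
  assumes nodom: "\<not> (\<exists>x\<in>V. \<exists>y\<in>V. x \<noteq> y \<and> lk E x \<subseteq> st E y)"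
  shows "\<exists>\<psi>. quasimorphism A \<psi> \<and> homogeneous A \<psi> \<and> aut_invariant A \<psi>
           \<and> (\<exists>C. \<forall>w\<in>words. \<bar>\<psi> (cls w) - total_count i w\<bar> \<le> C)"
proof -
  define f where "f g = total_count i (rep g)" for g
  define D where "D = card nonadjacent * (12 * real (i + 8))"
  have f_cls: "f (cls w) = total_count i w" if "w \<in> words" for w
    unfolding f_def using rep_cls[OF that] by (rule total_count_cong)
  have quasi: "\<bar>f g + f h - f (g \<otimes>\<^bsub>A\<^esub> h)\<bar> \<le> D" if "g \<in> carrier A" "h \<in> carrier A" for g h
    using that total_count_quasi[of i] by (auto simp: carrier_A mult_A f_cls D_def)
  then obtain \<psi> where \<psi>: "homogeneous A \<psi>" and close: "\<And>g. g \<in> carrier A \<Longrightarrow> \<bar>\<psi> g - f g\<bar> \<le> D"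
    using A.homogenization[of f D] by blast
  have "\<psi> (\<phi> g) = \<psi> g" if \<phi>: "\<phi> \<in> iso A A" and g: "g \<in> carrier A" for \<phi> g
  proof -
    interpret raag_aut V E "\<lambda>w. rep (\<phi> (cls w))" "\<lambda>w. rep (inv_into (carrier A) \<phi> (cls w))"
      using \<phi> nodom by (rule iso_raag_aut)
    obtain C where C: "\<And>w. w \<in> words \<Longrightarrow> \<bar>total_count i (rep (\<phi> (cls w))) - total_count i w\<bar> \<le> C"
      using total_count_aut[of i] by blast
    have "\<bar>\<psi> (\<phi> h) - \<psi> h\<bar> \<le> C + 2 * D" if h: "h \<in> carrier A" for h
    proof -
      obtain w where w: "w \<in> words" "h = cls w" using h by (auto simp: carrier_A)
      have "\<phi> h \<in> carrier A" using \<phi> h by (auto simp: iso_def hom_def)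
      from close[OF this] close[OF h] C[OF w(1)] show ?thesis
        using f_cls[OF w(1)] unfolding w(2) f_def by linarith
    qed
    from A.homogeneous_aut_invariant[OF \<psi> \<phi> this g] show ?thesis .
  qed
  then have "aut_invariant A \<psi>" by (simp add: aut_invariant_def)
  moreover have "quasimorphism A \<psi>" using quasimorphism_bounded_dist[OF group_A quasi close] .
  moreover have "\<bar>\<psi> (cls w) - total_count i w\<bar> \<le> D" if "w \<in> words" for w
    using close[of "cls w"] that by (simp add: carrier_A f_cls)
  ultimately show ?thesis using \<psi> by blast
qed

text \<open>On powers of the test word every pair other than \<open>(a, b)\<close> counts 0. The
  pair \<open>(a, b)\<close> counts at least \<open>n\<close> on the \<open>n\<close>-th power if
  \<open>i = j\<close>, and 0 otherwise.\<close>

lemma test_word_value: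
  assumes ab: "(a, b) \<in> nonadjacent" and \<psi>: "homogeneous A \<psi>"
    and C: "\<And>w. w \<in> words \<Longrightarrow> \<bar>\<psi> (cls w) - total_count i w\<bar> \<le> C"
  shows "\<psi> (cls (test_word j a b)) \<noteq> 0 \<longleftrightarrow> i = j"
proof -
  have ab': "a \<in> V" "b \<in> V" "a \<noteq> b" using ab by (auto simp: nonadjacent_def)
  let ?t = "test_word j a b" and ?g = "cls (test_word j a b)"
  have t: "?t \<in> words" using ab' by (auto simp: words_iff test_word_def pattern_def)
  have zero: "sym_count i x y (del {x, y} (concat (replicate n ?t))) = 0"
    if "(x, y) \<in> nonadjacent" "(x, y) \<noteq> (a, b) \<or> i \<noteq> j" for x y n
    using sym_count_test_zero[OF ab'(3) refl] that by (auto simp: nonadjacent_def)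
  have total: "total_count i (concat (replicate n ?t)) = sym_count i a b (del {a, b} (concat (replicate n ?t)))" for n
    unfolding total_count_def using ab zero finite_nonadjacent
    by (subst sum.remove[of _ "(a, b)"]) (auto intro!: sum.neutral)
  have tn: "concat (replicate n ?t) \<in> words" for n using t by (intro concat_words) auto
  have near: "\<bar>real n * \<psi> ?g - total_count i (concat (replicate n ?t))\<bar> \<le> C" for n
    using C[OF tn[of n]] A.homogeneous_nat_pow[OF \<psi>, of ?g n] pow_A[OF t, of n] t
    by (auto simp: carrier_A)
  show ?thesis
  proof
    assume "i = j"
    have "\<psi> ?g \<noteq> 0"
    proof
      assume 0: "\<psi> ?g = 0"
      have "real n * \<bar>1\<bar> \<le> C" for n
        using near[of n] sym_count_test_ge[OF ab'(3) refl, of n j] 0 total[of n] \<open>i = j\<close> by simp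
      from bounded_multiples_zero[OF this] show False by simp
    qed
    then show "\<psi> ?g \<noteq> 0" .
  next
    assume nz: "\<psi> ?g \<noteq> 0"
    show "i = j"
    proof (rule ccontr)
      assume "i \<noteq> j"
      then have "real n * \<bar>\<psi> ?g\<bar> \<le> C" for n
        using near[of n] zero[OF ab, of n] total[of n] by (simp add: abs_mult)
      then show False using bounded_multiples_zero nz by blast
    qed
  qed
qed

end

theorem theorem1p2:
  fixes V :: "'v set" and E :: "'v set set"
  assumes "finite_graph V E"
    and "card V \<ge> 2"
    and "\<not> (\<exists>x\<in>V. \<exists>y\<in>V. x \<noteq> y \<and> lk E x \<subseteq> st E y)"
  shows "\<exists>Q :: nat \<Rightarrow> ('v \<times> bool) list set \<Rightarrow> real.
           lin_indep_fun (RAAG V E) Q UNIV \<and>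
           (\<forall>i. quasimorphism (RAAG V E) (Q i) \<and> homogeneous (RAAG V E) (Q i)
                \<and> aut_invariant (RAAG V E) (Q i))"
proof -
  interpret raag V E by unfold_locales fact
  obtain a b where ab: "(a, b) \<in> nonadjacent"
  proof -
    obtain x where x: "x \<in> V" using assms(2) by fastforce
    moreover have "V \<noteq> {x}" using assms(2) by auto
    ultimately obtain y where "y \<in> V" "x \<noteq> y" by blast
    \<comment> \<open>A nonadjacent pair exists because the link of \<open>x\<close> is not inside
      the star of \<open>y\<close>.\<close>
    then obtain z where "z \<in> lk E x" "z \<notin> st E y" using x assms(3) by blast
    then have "(y, z) \<in> nonadjacent"
      using \<open>y \<in> V\<close> lk_V by (auto simp: nonadjacent_def st_def lk_def)
    then show ?thesis using that by blast
  qed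
  obtain Q where Q: "\<And>i. quasimorphism A (Q i)" "\<And>i. homogeneous A (Q i)" "\<And>i. aut_invariant A (Q i)"
    and C: "\<And>i. \<exists>C. \<forall>w\<in>words. \<bar>Q i (cls w) - total_count i w\<bar> \<le> C"
    using homogeneous_count[OF assms(3)] by metis
  have val: "Q i (cls (test_word j a b)) \<noteq> 0 \<longleftrightarrow> i = j" for i j
    using C[of i] test_word_value[OF ab Q(2)] by blast
  \<comment> \<open>Evaluating a vanishing combination at the \<open>j\<close>-th test word isolates
    the coefficient \<open>c j\<close>.\<close>
  have "lin_indep_fun A Q UNIV"
    unfolding lin_indep_fun_def
  proof (intro allI impI ballI, elim conjE)
    fix F and c :: "nat \<Rightarrow> real" and j
    assume F: "finite F" "\<forall>g\<in>carrier A. (\<Sum>i\<in>F. c i * Q i g) = 0" and j: "j \<in> F"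
    have "test_word j a b \<in> words"
      using ab by (auto simp: words_iff test_word_def pattern_def nonadjacent_def)
    then have "(\<Sum>i\<in>F. c i * Q i (cls (test_word j a b))) = 0" using F by (simp add: carrier_A)
    moreover have "(\<Sum>i\<in>F - {j}. c i * Q i (cls (test_word j a b))) = 0"
      using val by (intro sum.neutral) auto
    ultimately have "c j * Q j (cls (test_word j a b)) = 0" using F j by (simp add: sum.remove)
    then show "c j = 0" using val[of j j] by simp
  qed
  then show ?thesis using Q by blast
qed

end
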